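(* There is no universal weak-majorization comparison, in either direction, between the Kubo-Ando Heron expression $a^2A+b^2B+2ab(A\#B)$ and the spectral Heron expression $a^2A+b^2B+2ab(A\natural B)$, and this failure occurs already for $a=b=1$: neither $$\lambda\bigl(A+B+2(A\#B)\bigr)\prec_w\lambda\bigl(A+B+2(A\natural B)\bigr)$$ nor $$\lambda\bigl(A+B+2(A\natural B)\bigr)\prec_w\lambda\bigl(A+B+2(A\#B)\bigr)$$ holds for all $n\ge1$ and all $A,B\in\mathbb P_n$. That is, there exist $n$ and $A,B\in\mathbb P_n$ for which the first relation fails, and there exist $n$ and $A,B\in\mathbb P_n$ for which the second relation fails.
   Context: $\mathbb P_n$ is the set of $n\times n$ complex (Hermitian) positive definite matrices. For a Hermitian matrix $T$, $\lambda(T)$ is the vector of eigenvalues in decreasing order. For $x,y\in\mathbb R^n$ with decreasing rearrangements $x^\downarrow,y^\downarrow$, $x\prec_w y$ means $\sum_{j=1}^k x_j^\downarrow\le\sum_{j=1}^k y_j^\downarrow$ for all $1\le k\le n$. For $P,Q\in\mathbb P_n$, $P\#Q=P^{1/2}(P^{-1/2}QP^{-1/2})^{1/2}P^{1/2}$ is the Kubo-Ando geometric mean and $P\natural Q=(P^{-1}\#Q)^{1/2}P(P^{-1}\#Q)^{1/2}$ is the spectral geometric mean. *)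

theory Defs
  imports
    "HOL-Computational_Algebra.Fundamental_Theorem_Algebra"
    "Jordan_Normal_Form.Gauss_Jordan_Elimination"
    "Jordan_Normal_Form.Schur_Decomposition"
begin

definition pos_def_mats :: "nat \<Rightarrow> complex mat set" where
  "pos_def_mats n = {A \<in> carrier_mat n n. mat_adjoint A = A \<and>
     (\<forall>v \<in> carrier_vec n. v \<noteq> 0\<^sub>v n \<longrightarrow> 0 < Re ((A *\<^sub>v v) \<bullet>c v))}"

text \<open>On positive definite matrices the positive definite square root exists and is unique,
  and \<^const>\<open>mat_inverse\<close> returns \<^term>\<open>Some\<close> of the inverse. The values of the following functions
  outside of positive definite matrices are irrelevant.\<close>

definition mat_sqrt :: "complex mat \<Rightarrow> complex mat" where
  "mat_sqrt P = (THE S. S \<in> pos_def_mats (dim_row P) \<and> S * S = P)"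

abbreviation mat_inv :: "complex mat \<Rightarrow> complex mat" where
  "mat_inv P \<equiv> the (mat_inverse P)"

definition geometric_mean :: "complex mat \<Rightarrow> complex mat \<Rightarrow> complex mat" where
  "geometric_mean P Q =
     mat_sqrt P * mat_sqrt (mat_inv (mat_sqrt P) * Q * mat_inv (mat_sqrt P)) * mat_sqrt P"

definition spectral_geometric_mean :: "complex mat \<Rightarrow> complex mat \<Rightarrow> complex mat" where
  "spectral_geometric_mean P Q =
     mat_sqrt (geometric_mean (mat_inv P) Q) * P * mat_sqrt (geometric_mean (mat_inv P) Q)"

text \<open>Eigenvalues with multiplicity, in decreasing order; meant for Hermitian matrices, for which
  all roots of the characteristic polynomial are real.\<close>

definition eigenvalues_desc :: "complex mat \<Rightarrow> real list" where
  "eigenvalues_desc T = rev (sorted_list_of_multiset (image_mset Re (proots (char_poly T))))"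

text \<open>Vectors in $n$-dimensional real space are represented as lists of length $n$.\<close>

definition weakly_majorized :: "real list \<Rightarrow> real list \<Rightarrow> bool" (infix \<open>\<prec>\<^sub>w\<close> 50) where
  "x \<prec>\<^sub>w y \<longleftrightarrow> length x = length y \<and>
     (\<forall>k \<in> {1..length x}. sum_list (take k (rev (sort x))) \<le> sum_list (take k (rev (sort y))))"

end

theory Submission
  imports Defs
begin

text \<open>
  One pair \<open>(A, B)\<close> of size three refutes both relations. Write \<open>B = X A X\<close> with \<open>X = S\<^sup>2\<close>
  positive definite. Then \<open>X\<close> solves the Riccati equation \<open>X A X = B\<close>, so \<open>X = A\<^sup>-\<^sup>1 # B\<close> and
  the spectral mean is the explicit matrix \<open>S A S\<close>; choosing \<open>A\<close> and \<open>S\<close> instead of \<open>A\<close> and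
  \<open>B\<close> keeps everything on the spectral side rational. The Kubo-Ando mean \<open>G = A # B\<close> is the
  positive definite solution of \<open>G A\<^sup>-\<^sup>1 G = B\<close>; its entries are in general irrational, and the
  argument reaches it only through this equation.

  The trace separates the means one way round. With \<open>M = A S - G S\<^sup>-\<^sup>1\<close> one finds
  \<open>tr (M\<^sup>* A\<^sup>-\<^sup>1 M) = 2 tr (S A S) - 2 tr G\<close>, which is positive unless
  \<open>M = 0\<close>; and \<open>M = 0\<close> would make \<open>A X = G\<close> Hermitian. Hence
  \<open>tr (A # B) < tr (A \<natural> B)\<close> as soon as \<open>A\<close> and \<open>X\<close> do not commute
  (\<open>trace_geometric_mean_less\<close>). The sum of all eigenvalues is the trace, so the spectral Heron
  expression is not weakly majorized by the Kubo-Ando one.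

  The largest eigenvalue can separate them the other way round: although \<open>G\<close> has the smaller
  trace, it need not lie below \<open>S A S\<close> as an operator, and the summand \<open>A + B\<close> can single out a
  direction in which \<open>G\<close> is the larger of the two. In the example \<open>S\<close> is nearly singular,
  and the vector that it nearly annihilates has its largest component along the top eigenvector
  of \<open>A\<close>. The top eigenvalues
  of \<open>A + B + 2 G\<close> and \<open>A + B + 2 S A S\<close> are about 12.343 and 12.328, and \<open>37/3\<close> lies
  between them. That \<open>37/3\<close> dominates the second matrix is a finite rational computation. That
  the first matrix exceeds it uses the extremal property of the geometric mean:
  \<open>G\<close> is the largest Hermitian \<open>Z\<close> with \<open>Z A\<^sup>-\<^sup>1 Z \<le> B\<close> (\<open>geometric_mean_maximal\<close>), so \<open>G\<close> is bounded
  below by a rational \<open>Z = X W X\<close>, and a Rayleigh quotient with \<open>Z\<close> in place of \<open>G\<close> is already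
  above \<open>37/3\<close>.

  Both arguments, and the existence and uniqueness of the square roots behind the two means, rest
  on the spectral theorem for Hermitian matrices.
\<close>

section \<open>Adjoints and quadratic forms\<close>

lemma dim_mat_adjoint [simp]:
  "dim_row (mat_adjoint A) = dim_col A" "dim_col (mat_adjoint A) = dim_row A"
  by (auto simp: mat_adjoint_def)

lemma mat_adjoint_carrier:
  "A \<in> carrier_mat m n \<Longrightarrow> mat_adjoint A \<in> carrier_mat n m"
  by (intro carrier_matI) auto

lemma index_mat_adjoint [simp]:
  fixes A :: "complex mat"
  shows "i < dim_col A \<Longrightarrow> j < dim_row A \<Longrightarrow> mat_adjoint A $$ (i, j) = cnj (A $$ (j, i))"
  by (simp add: mat_adjoint_def mat_of_rows_index)

lemma mat_adjoint_adjoint [simp]: "mat_adjoint (mat_adjoint A) = (A :: complex mat)"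
  by (rule eq_matI) auto

lemma mat_adjoint_one [simp]: "mat_adjoint (1\<^sub>m n) = (1\<^sub>m n :: complex mat)"
  by (rule eq_matI) auto

lemma mat_adjoint_mult:
  fixes A B :: "complex mat"
  assumes "A \<in> carrier_mat l m" "B \<in> carrier_mat m n"
  shows "mat_adjoint (A * B) = mat_adjoint B * mat_adjoint A"
  by (rule eq_matI) (use assms in \<open>auto simp: scalar_prod_def mult.commute\<close>)

lemma mat_adjoint_add:
  fixes A B :: "complex mat"
  assumes "A \<in> carrier_mat m n" "B \<in> carrier_mat m n"
  shows "mat_adjoint (A + B) = mat_adjoint A + mat_adjoint B"
  by (rule eq_matI) (use assms in auto)

lemma mat_adjoint_minus:
  fixes A B :: "complex mat"
  assumes "A \<in> carrier_mat m n" "B \<in> carrier_mat m n"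
  shows "mat_adjoint (A - B) = mat_adjoint A - mat_adjoint B"
  by (rule eq_matI) (use assms in auto)

lemma mat_adjoint_smult:
  fixes A :: "complex mat"
  shows "mat_adjoint (c \<cdot>\<^sub>m A) = cnj c \<cdot>\<^sub>m mat_adjoint A"
  by (rule eq_matI) auto

lemma mult_mat_vec_cscalar:
  fixes A :: "complex mat"
  assumes A: "A \<in> carrier_mat m n" and v: "v \<in> carrier_vec n" and w: "w \<in> carrier_vec m"
  shows "(A *\<^sub>v v) \<bullet>c w = v \<bullet>c (mat_adjoint A *\<^sub>v w)"
proof -
  have "(A *\<^sub>v v) \<bullet>c w = (\<Sum>i<m. \<Sum>j<n. A $$ (i,j) * v $ j * cnj (w $ i))"
    using assms by (auto simp: scalar_prod_def sum_distrib_right atLeast0LessThan intro!: sum.cong)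
  also have "\<dots> = (\<Sum>j<n. \<Sum>i<m. A $$ (i,j) * v $ j * cnj (w $ i))"
    by (rule sum.swap)
  also have "\<dots> = v \<bullet>c (mat_adjoint A *\<^sub>v w)"
    using assms by (auto simp: scalar_prod_def sum_distrib_left atLeast0LessThan mult_ac intro!: sum.cong)
  finally show ?thesis .
qed

lemma cscalar_self:
  fixes v :: "complex vec"
  assumes "v \<in> carrier_vec n"
  shows "v \<bullet>c v = complex_of_real (\<Sum>i<n. (cmod (v $ i))\<^sup>2)"
  using assms by (auto simp: scalar_prod_def atLeast0LessThan complex_norm_square[symmetric] intro!: sum.cong)

lemma Re_cscalar_self_pos:
  fixes v :: "complex vec"
  assumes "v \<in> carrier_vec n" "v \<noteq> 0\<^sub>v n"
  shows "0 < Re (v \<bullet>c v)"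
proof -
  obtain i where "i < n" "v $ i \<noteq> 0"
    using assms by (metis carrier_vecD eq_vecI index_zero_vec)
  then show ?thesis
    unfolding cscalar_self[OF assms(1)] by (auto intro!: sum_pos2[of _ i])
qed

definition hermitian_mats :: "nat \<Rightarrow> complex mat set" where
  "hermitian_mats n = {A \<in> carrier_mat n n. mat_adjoint A = A}"

lemma hermitian_carrier: "A \<in> hermitian_mats n \<Longrightarrow> A \<in> carrier_mat n n"
  and hermitian_adjoint: "A \<in> hermitian_mats n \<Longrightarrow> mat_adjoint A = A"
  by (auto simp: hermitian_mats_def)

lemma hermitian_add:
  "A \<in> hermitian_mats n \<Longrightarrow> B \<in> hermitian_mats n \<Longrightarrow> A + B \<in> hermitian_mats n"
  by (auto simp: hermitian_mats_def mat_adjoint_add)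

lemma hermitian_minus:
  "A \<in> hermitian_mats n \<Longrightarrow> B \<in> hermitian_mats n \<Longrightarrow> A - B \<in> hermitian_mats n"
  by (auto simp: hermitian_mats_def mat_adjoint_minus)

lemma hermitian_smult:
  "A \<in> hermitian_mats n \<Longrightarrow> cnj c = c \<Longrightarrow> c \<cdot>\<^sub>m A \<in> hermitian_mats n"
  by (auto simp: hermitian_mats_def mat_adjoint_smult)

lemma hermitian_congruence:
  assumes "A \<in> hermitian_mats n" "M \<in> carrier_mat n m"
  shows "mat_adjoint M * A * M \<in> hermitian_mats m"
proof -
  note c = hermitian_carrier[OF assms(1)] assms(2) mat_adjoint_carrier[OF assms(2)]
  have "mat_adjoint (mat_adjoint M * A * M) = mat_adjoint M * (A * M)"
    using c by (simp add: mat_adjoint_mult[of _ m n _ m] mat_adjoint_mult[of _ n n _ m] hermitian_adjoint[OF assms(1)])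
  then show ?thesis
    using c by (auto simp: hermitian_mats_def)
qed

definition qform :: "complex mat \<Rightarrow> complex vec \<Rightarrow> real" where
  "qform A v = Re ((A *\<^sub>v v) \<bullet>c v)"

lemma pos_def_mats_iff:
  "A \<in> pos_def_mats n \<longleftrightarrow> A \<in> hermitian_mats n \<and> (\<forall>v \<in> carrier_vec n. v \<noteq> 0\<^sub>v n \<longrightarrow> 0 < qform A v)"
  by (auto simp: pos_def_mats_def hermitian_mats_def qform_def)

lemma pos_def_hermitian: "A \<in> pos_def_mats n \<Longrightarrow> A \<in> hermitian_mats n"
  and pos_def_carrier: "A \<in> pos_def_mats n \<Longrightarrow> A \<in> carrier_mat n n"
  and pos_def_adjoint: "A \<in> pos_def_mats n \<Longrightarrow> mat_adjoint A = A"
  by (auto simp: pos_def_mats_def hermitian_mats_def)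

lemma pos_def_qform_pos:
  "A \<in> pos_def_mats n \<Longrightarrow> v \<in> carrier_vec n \<Longrightarrow> v \<noteq> 0\<^sub>v n \<Longrightarrow> 0 < qform A v"
  by (auto simp: pos_def_mats_iff)

lemma qform_add:
  assumes "A \<in> carrier_mat n n" "B \<in> carrier_mat n n" "v \<in> carrier_vec n"
  shows "qform (A + B) v = qform A v + qform B v"
  using assms
  by (simp add: qform_def add_mult_distrib_mat_vec[of _ n n] add_scalar_prod_distrib[of _ n])

lemma qform_minus:
  assumes "A \<in> carrier_mat n n" "B \<in> carrier_mat n n" "v \<in> carrier_vec n"
  shows "qform (A - B) v = qform A v - qform B v"
  using assms
  by (simp add: qform_def minus_mult_distrib_mat_vec[of _ n n] minus_scalar_prod_distrib[of _ n])

lemma qform_smult: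
  assumes "A \<in> carrier_mat n n" "v \<in> carrier_vec n"
  shows "qform (complex_of_real c \<cdot>\<^sub>m A) v = c * qform A v"
proof -
  have "(complex_of_real c \<cdot>\<^sub>m A) *\<^sub>v v = complex_of_real c \<cdot>\<^sub>v (A *\<^sub>v v)"
    using assms by (intro eq_vecI) auto
  then show ?thesis
    using assms by (simp add: qform_def)
qed

lemma qform_one: "v \<in> carrier_vec n \<Longrightarrow> qform (1\<^sub>m n) v = Re (v \<bullet>c v)"
  by (simp add: qform_def)

lemma qform_congruence:
  assumes "P \<in> carrier_mat n n" "M \<in> carrier_mat n m" "v \<in> carrier_vec m"
  shows "qform (mat_adjoint M * P * M) v = qform P (M *\<^sub>v v)"
proof -
  note M' = mat_adjoint_carrier[OF assms(2)]
  have "(mat_adjoint M * P * M) *\<^sub>v v = mat_adjoint M *\<^sub>v (P *\<^sub>v (M *\<^sub>v v))"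
    using assms M' by (simp add: assoc_mult_mat_vec[of _ m n _ m] assoc_mult_mat_vec[of _ m n _ n])
  then show ?thesis
    unfolding qform_def
    using assms M' by (simp add: mult_mat_vec_cscalar[of "mat_adjoint M" m n])
qed

section \<open>The spectral theorem\<close>

definition real_diag :: "nat \<Rightarrow> (nat \<Rightarrow> real) \<Rightarrow> complex mat" where
  "real_diag n d = mat n n (\<lambda>(i, j). if i = j then complex_of_real (d i) else 0)"

lemma real_diag_carrier [simp]: "real_diag n d \<in> carrier_mat n n"
  by (simp add: real_diag_def)

text \<open>Complete \<open>v\<close> to a basis, apply Gram-Schmidt, which keeps the first vector, and normalize the
  resulting orthogonal basis. The index 0 is legitimate because \<open>v \<noteq> 0\<close> forces \<open>n > 0\<close>.\<close>

lemma unitary_with_first_column: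
  fixes v :: "complex vec"
  assumes v: "v \<in> carrier_vec n" "v \<noteq> 0\<^sub>v n"
  obtains U c where "U \<in> carrier_mat n n" "mat_adjoint U * U = 1\<^sub>m n"
    "col U 0 = c \<cdot>\<^sub>v v"
proof -
  interpret cof_vec_space n "TYPE(complex)" .
  define b where "b = basis_completion v"
  from basis_completion[OF v, folded b_def]
  have dist: "distinct b" and indep: "\<not> lin_dep (set b)" and b: "set b \<subseteq> carrier_vec n"
    and hdb: "hd b = v" and lenb: "length b = n" by auto
  have n: "n \<noteq> 0" using v by auto
  then obtain vs where bv: "b = v # vs" using hdb lenb by (cases b) auto
  define ws where "ws = gram_schmidt n b"
  from gram_schmidt_result[OF b dist indep ws_def]
  have ws: "set ws \<subseteq> carrier_vec n" "corthogonal ws" "length ws = n" by (auto simp: lenb)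
  have hdws: "hd ws = v"
    unfolding ws_def bv using v(1) by (rule gram_schmidt_hd)
  have wi: "ws ! i \<in> carrier_vec n" if "i < n" for i using that ws by auto
  define r where "r i = sqrt (Re (ws ! i \<bullet>c ws ! i))" for i
  have orth: "(ws ! i \<bullet>c ws ! j = 0) = (i \<noteq> j)" if "i < n" "j < n" for i j
    using corthogonalD[OF ws(2)] that ws(3) by auto
  have self: "ws ! i \<bullet>c ws ! i = complex_of_real ((r i)\<^sup>2)" "r i \<noteq> 0" if "i < n" for i
  proof -
    have *: "ws ! i \<bullet>c ws ! i = complex_of_real (\<Sum>k<n. (cmod (ws ! i $ k))\<^sup>2)"
      using cscalar_self[OF wi[OF that]] .
    have "(\<Sum>k<n. (cmod (ws ! i $ k))\<^sup>2) \<ge> 0" by (auto intro!: sum_nonneg)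
    then show "ws ! i \<bullet>c ws ! i = complex_of_real ((r i)\<^sup>2)"
      unfolding r_def * by simp
    then show "r i \<noteq> 0" using orth[OF that that] by auto
  qed
  define us where "us i = complex_of_real (1 / r i) \<cdot>\<^sub>v (ws ! i)" for i
  define U where "U = mat n n (\<lambda>(i, j). us j $ i)"
  have U: "U \<in> carrier_mat n n" by (simp add: U_def)
  have colU: "col U j = us j" if "j < n" for j
    using that wi[OF that] by (auto simp: U_def us_def)
  have "mat_adjoint U * U = 1\<^sub>m n"
  proof (rule eq_matI)
    fix i j assume "i < dim_row (1\<^sub>m n :: complex mat)" "j < dim_col (1\<^sub>m n :: complex mat)"
    then have ij: "i < n" "j < n" by auto
    have "(mat_adjoint U * U) $$ (i, j) = us j \<bullet>c us i"
      using ij U wi[OF ij(1)] wi[OF ij(2)]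
      by (auto simp: scalar_prod_def U_def us_def mult_ac intro!: sum.cong)
    also have "\<dots> = complex_of_real (1 / r j) * (complex_of_real (1 / r i) * (ws ! j \<bullet>c ws ! i))"
      using wi[OF ij(1)] wi[OF ij(2)] by (simp add: us_def conjugate_smult_vec)
    also have "\<dots> = 1\<^sub>m n $$ (i, j)"
      using ij orth[OF ij(2,1)] self[OF ij(1)] by (auto simp: power2_eq_square)
    finally show "(mat_adjoint U * U) $$ (i, j) = 1\<^sub>m n $$ (i, j)" .
  qed (use U in auto)
  moreover have "col U 0 = complex_of_real (1 / r 0) \<cdot>\<^sub>v v"
    using colU[of 0] n hdws ws(3) by (simp add: us_def hd_conv_nth flip: length_greater_0_conv)
  ultimately show ?thesis using U that by blast
qed

lemma real_diag_adjoint [simp]: "mat_adjoint (real_diag n d) = real_diag n d"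
  by (rule eq_matI) (auto simp: real_diag_def)

text \<open>Induction on the size. A unitary matrix whose first column is an eigenvector turns \<open>A\<close> into a matrix
  whose first column vanishes below the diagonal; as that matrix is Hermitian, its first row vanishes as well
  and the corner entry is real. What remains is a Hermitian block of size one less.\<close>

lemma spectral_theorem:
  assumes "A \<in> hermitian_mats n"
  obtains U d where "U \<in> carrier_mat n n" "mat_adjoint U * U = 1\<^sub>m n" "U * mat_adjoint U = 1\<^sub>m n"
    "A = U * real_diag n d * mat_adjoint U"
proof -
  have "\<exists>U d. U \<in> carrier_mat n n \<and> mat_adjoint U * U = 1\<^sub>m n \<and> mat_adjoint U * A * U = real_diag n d"
    using assms
  proof (induction n arbitrary: A)
    case 0
    then show ?case
      by (intro exI[of _ "1\<^sub>m 0"] exI[of _ "\<lambda>_. 0"])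
         (auto simp: real_diag_def hermitian_mats_def intro!: eq_matI)
  next
    case (Suc n)
    note A = hermitian_carrier[OF Suc.prems]
    obtain e where "eigenvalue A e"
    proof -
      have "degree (char_poly A) = Suc n"
        using degree_monic_char_poly[OF A] by simp
      then have "\<not> constant (poly (char_poly A))"
        by (simp add: constant_degree)
      then obtain e where "poly (char_poly A) e = 0"
        using fundamental_theorem_of_algebra by blast
      then show ?thesis using that eigenvalue_root_char_poly[OF A] by blast
    qed
    then obtain v where v: "v \<in> carrier_vec (Suc n)" "v \<noteq> 0\<^sub>v (Suc n)" "A *\<^sub>v v = e \<cdot>\<^sub>v v"
      using A by (auto simp: eigenvalue_def eigenvector_def)
    obtain U c where U: "U \<in> carrier_mat (Suc n) (Suc n)" "mat_adjoint U * U = 1\<^sub>m (Suc n)"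
      and col0: "col U 0 = c \<cdot>\<^sub>v v"
      using unitary_with_first_column[OF v(1,2)] .
    note U' = mat_adjoint_carrier[OF U(1)]
    define H where "H = mat_adjoint U * A * U"
    have H: "H \<in> hermitian_mats (Suc n)"
      unfolding H_def by (rule hermitian_congruence[OF Suc.prems U(1)])
    note Hc = hermitian_carrier[OF H]
    have Hsym: "H $$ (i, j) = cnj (H $$ (j, i))" if "i < Suc n" "j < Suc n" for i j
      using hermitian_adjoint[OF H] index_mat_adjoint[of i H j] that Hc by simp
    have H0: "H $$ (i, 0) = (if i = 0 then e else 0)" if "i < Suc n" for i
    proof -
      have "A *\<^sub>v col U 0 = e \<cdot>\<^sub>v col U 0"
        using A v by (auto simp: col0 mult_mat_vec[of _ "Suc n" "Suc n"] smult_smult_assoc mult.commute)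
      moreover have "col H 0 = mat_adjoint U *\<^sub>v (A *\<^sub>v col U 0)"
        unfolding H_def assoc_mult_mat[OF U' A U(1)]
        by (simp only: col_mult2[OF U' mult_carrier_mat[OF A U(1)]] col_mult2[OF A U(1)] zero_less_Suc)
      moreover have "mat_adjoint U *\<^sub>v col U 0 = col (1\<^sub>m (Suc n)) 0"
        using U U' by (simp add: col_mult2[of _ "Suc n" "Suc n" _ "Suc n", symmetric])
      moreover have "mat_adjoint U *\<^sub>v (e \<cdot>\<^sub>v col U 0) = e \<cdot>\<^sub>v (mat_adjoint U *\<^sub>v col U 0)"
        using U(1) U' by (intro mult_mat_vec[of _ "Suc n" "Suc n"]) (auto intro: carrier_vecI)
      ultimately have "col H 0 = e \<cdot>\<^sub>v col (1\<^sub>m (Suc n)) 0"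
        by simp
      then have "col H 0 $ i = (e \<cdot>\<^sub>v col (1\<^sub>m (Suc n)) 0) $ i"
        by simp
      then show ?thesis
        using that Hc by (simp add: one_mat_def split: if_splits)
    qed
    have e: "cnj e = e" using Hsym[of 0 0] H0[of 0] by simp
    define K where "K = mat n n (\<lambda>(i, j). H $$ (Suc i, Suc j))"
    have Hblock: "H = four_block_mat (mat 1 1 (\<lambda>_. e)) (0\<^sub>m 1 n) (0\<^sub>m n 1) K"
    proof (rule eq_matI, goal_cases)
      case (1 i j)
      then show ?case
        using Hc H0[of i] H0[of j] Hsym[of 0 j]
        by (cases i; cases j) (auto simp: K_def)
    qed (use Hc in \<open>auto simp: K_def\<close>)
    have "K \<in> hermitian_mats n"
      unfolding hermitian_mats_def
      by (auto simp: K_def Hsym[symmetric] intro!: eq_matI)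
    from Suc.IH[OF this] obtain V d where V: "V \<in> carrier_mat n n" "mat_adjoint V * V = 1\<^sub>m n"
      "mat_adjoint V * K * V = real_diag n d" by blast
    note V' = mat_adjoint_carrier[OF V(1)]
    define W where "W = four_block_mat (1\<^sub>m 1) (0\<^sub>m 1 n) (0\<^sub>m n 1) V"
    have W: "W \<in> carrier_mat (Suc n) (Suc n)"
      using V by (auto simp: W_def)
    note W' = mat_adjoint_carrier[OF W]
    have adjW: "mat_adjoint W = four_block_mat (1\<^sub>m 1) (0\<^sub>m 1 n) (0\<^sub>m n 1) (mat_adjoint V)"
      by (rule eq_matI) (use V in \<open>auto simp: W_def\<close>)
    have WW: "mat_adjoint W * W = 1\<^sub>m (Suc n)"
      unfolding adjW unfolding W_def
      using V V' by (subst mult_four_block_mat[of _ 1 1 _ n _ n _ _ 1 _ n]) auto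
    have K: "K \<in> carrier_mat n n" by (simp add: K_def)
    define E where "E = mat 1 1 (\<lambda>_. e)"
    have E: "E \<in> carrier_mat 1 1" by (simp add: E_def)
    have z: "0\<^sub>m 1 n \<in> carrier_mat 1 n" "0\<^sub>m n 1 \<in> carrier_mat n 1" "1\<^sub>m 1 \<in> carrier_mat 1 1"
      by simp_all
    have VK: "mat_adjoint V * K \<in> carrier_mat n n" using V' K by simp
    have "mat_adjoint W * H = four_block_mat E (0\<^sub>m 1 n) (0\<^sub>m n 1) (mat_adjoint V * K)"
      unfolding adjW Hblock E_def[symmetric]
      using mult_four_block_mat[OF z(3,1,2) V' E z(1,2) K] E V' K right_mult_zero_mat[OF V', of 1]
      by simp
    then have "mat_adjoint W * H * W = four_block_mat E (0\<^sub>m 1 n) (0\<^sub>m n 1) (real_diag n d)"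
      unfolding W_def
      using mult_four_block_mat[OF E z(1,2) VK z(3,1,2) V(1)] E V VK right_mult_zero_mat[OF VK, of 1]
      by simp
    also have "\<dots> = real_diag (Suc n) (\<lambda>i. if i = 0 then Re e else d (i - 1))"
      using e by (intro eq_matI) (auto simp: real_diag_def complex_eq_iff E_def)
    finally have WHW: "mat_adjoint W * H * W = real_diag (Suc n) (\<lambda>i. if i = 0 then Re e else d (i - 1))" .
    have "mat_adjoint (U * W) * (U * W) = mat_adjoint W * (mat_adjoint U * U) * W"
      using U(1) U' W W'
      by (simp add: mat_adjoint_mult[of _ "Suc n" "Suc n" _ "Suc n"] assoc_mult_mat[of _ "Suc n" "Suc n" _ "Suc n" _ "Suc n"])
    then have "mat_adjoint (U * W) * (U * W) = 1\<^sub>m (Suc n)"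
      using U W W' WW by simp
    moreover have "mat_adjoint (U * W) * A * (U * W) = mat_adjoint W * H * W"
      unfolding H_def using U(1) U' W W' A
      by (simp add: mat_adjoint_mult[of _ "Suc n" "Suc n" _ "Suc n"] assoc_mult_mat[of _ "Suc n" "Suc n" _ "Suc n" _ "Suc n"])
    moreover have "U * W \<in> carrier_mat (Suc n) (Suc n)" using U W by simp
    ultimately show ?case using WHW by metis
  qed
  then obtain U d where U: "U \<in> carrier_mat n n" "mat_adjoint U * U = 1\<^sub>m n"
    "mat_adjoint U * A * U = real_diag n d" by blast
  note U' = mat_adjoint_carrier[OF U(1)]
  note A = hermitian_carrier[OF assms]
  have UU: "U * mat_adjoint U = 1\<^sub>m n"
    using mat_mult_left_right_inverse[OF U' U(1) U(2)] .
  have "U * real_diag n d * mat_adjoint U = (U * mat_adjoint U) * A * (U * mat_adjoint U)"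
    unfolding U(3)[symmetric] using A U(1) U' by (simp add: assoc_mult_mat[of _ n n _ n _ n])
  then have "A = U * real_diag n d * mat_adjoint U"
    using A UU by simp
  with U UU that show ?thesis by blast
qed

lemma mult_mat_vec_zero: "A \<in> carrier_mat m n \<Longrightarrow> A *\<^sub>v 0\<^sub>v n = (0\<^sub>v m :: complex vec)"
  by (intro eq_vecI) auto

lemma pos_def_qform_nonneg:
  assumes "P \<in> pos_def_mats n" "v \<in> carrier_vec n"
  shows "0 \<le> qform P v"
  using pos_def_qform_pos[OF assms] pos_def_carrier[OF assms(1)]
  by (cases "v = 0\<^sub>v n") (auto simp: qform_def mult_mat_vec_zero)

lemma mat_mult_unit_vec:
  "A \<in> carrier_mat m n \<Longrightarrow> i < n \<Longrightarrow> A *\<^sub>v unit_vec n i = (col A i :: complex vec)"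
  by (intro eq_vecI) auto

lemma qform_real_diag:
  assumes "w \<in> carrier_vec n"
  shows "qform (real_diag n d) w = (\<Sum>i<n. d i * (cmod (w $ i))\<^sup>2)"
proof -
  have "(real_diag n d *\<^sub>v w) $ i = complex_of_real (d i) * w $ i" if "i < n" for i
    using that assms
    by (simp add: real_diag_def scalar_prod_def if_distrib[of "\<lambda>x. x * c" for c] cong: if_cong)
  then have "(real_diag n d *\<^sub>v w) \<bullet>c w = (\<Sum>i<n. complex_of_real (d i * (cmod (w $ i))\<^sup>2))"
    using assms unfolding scalar_prod_def
    by (auto simp: atLeast0LessThan mult.assoc complex_norm_square[symmetric] intro!: sum.cong)
  then show ?thesis
    by (simp add: qform_def)
qed

lemma unitary_norm:
  fixes U :: "complex mat" and v :: "complex vec"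
  assumes "U \<in> carrier_mat n n" "U * mat_adjoint U = 1\<^sub>m n" "v \<in> carrier_vec n"
  shows "(mat_adjoint U *\<^sub>v v) \<bullet>c (mat_adjoint U *\<^sub>v v) = v \<bullet>c v"
proof -
  note U' = mat_adjoint_carrier[OF assms(1)]
  have "(mat_adjoint U *\<^sub>v v) \<bullet>c (mat_adjoint U *\<^sub>v v) = v \<bullet>c (U *\<^sub>v (mat_adjoint U *\<^sub>v v))"
    using mult_mat_vec_cscalar[OF U' assms(3) mult_mat_vec_carrier[OF U' assms(3)]] by simp
  also have "U *\<^sub>v (mat_adjoint U *\<^sub>v v) = v"
    using assms U' assoc_mult_mat_vec[of U n n "mat_adjoint U" n v] by simp
  finally show ?thesis .
qed

lemma qform_spectral:
  assumes U: "U \<in> carrier_mat n n" and A: "A = U * real_diag n d * mat_adjoint U"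
    and v: "v \<in> carrier_vec n"
  shows "qform A v = (\<Sum>i<n. d i * (cmod ((mat_adjoint U *\<^sub>v v) $ i))\<^sup>2)"
proof -
  note U' = mat_adjoint_carrier[OF U]
  have "qform A v = qform (real_diag n d) (mat_adjoint U *\<^sub>v v)"
    using qform_congruence[OF real_diag_carrier U' v, of d] A by simp
  then show ?thesis using U' v by (simp add: qform_real_diag)
qed

lemma spectral_eigenvector:
  assumes U: "U \<in> carrier_mat n n" "mat_adjoint U * U = 1\<^sub>m n"
    and A: "A = U * real_diag n d * mat_adjoint U" and i: "i < n"
  shows "A *\<^sub>v col U i = complex_of_real (d i) \<cdot>\<^sub>v col U i" "col U i \<bullet>c col U i = 1"
proof -
  note U' = mat_adjoint_carrier[OF U(1)]
  have u: "col U i \<in> carrier_vec n" using U(1) by (auto intro: carrier_vecI)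
  have e: "mat_adjoint U *\<^sub>v col U i = unit_vec n i"
    using col_mult2[OF U' U(1) i] U i by simp
  have "A *\<^sub>v col U i = U *\<^sub>v (real_diag n d *\<^sub>v (mat_adjoint U *\<^sub>v col U i))"
    using U(1) U' u real_diag_carrier[of n d] unfolding A
    by (simp add: assoc_mult_mat_vec[of _ n n _ n])
  also have "real_diag n d *\<^sub>v (mat_adjoint U *\<^sub>v col U i) = complex_of_real (d i) \<cdot>\<^sub>v unit_vec n i"
    unfolding e using i by (intro eq_vecI) (auto simp: real_diag_def)
  also have "U *\<^sub>v (complex_of_real (d i) \<cdot>\<^sub>v unit_vec n i) = complex_of_real (d i) \<cdot>\<^sub>v col U i"
    using U(1) i mat_mult_unit_vec[OF U(1) i] mult_mat_vec[OF U(1), of "unit_vec n i"] by simp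
  finally show "A *\<^sub>v col U i = complex_of_real (d i) \<cdot>\<^sub>v col U i" .
  have "col U i \<bullet>c col U i = unit_vec n i \<bullet>c col (1\<^sub>m n) i"
    using mult_mat_vec_cscalar[of U n n "unit_vec n i" "col U i"] U(1) u e i mat_mult_unit_vec[OF U(1) i]
    by simp
  also have "\<dots> = 1" using i by simp
  finally show "col U i \<bullet>c col U i = 1" .
qed

text \<open>Turns a statement about all vectors into one about eigenvectors, where a Hermitian matrix acts as
  a real number.\<close>

lemma qform_nonneg_if_eigenvalues_nonneg:
  assumes H: "H \<in> hermitian_mats n"
    and ev: "\<And>\<mu> u. u \<in> carrier_vec n \<Longrightarrow> u \<noteq> 0\<^sub>v n \<Longrightarrow> H *\<^sub>v u = complex_of_real \<mu> \<cdot>\<^sub>v u \<Longrightarrow> 0 \<le> \<mu>"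
    and v: "v \<in> carrier_vec n"
  shows "0 \<le> qform H v"
proof -
  obtain U d where U: "U \<in> carrier_mat n n" "mat_adjoint U * U = 1\<^sub>m n"
    and HU: "H = U * real_diag n d * mat_adjoint U"
    using spectral_theorem[OF H] by blast
  have "0 \<le> d i" if "i < n" for i
  proof (rule ev)
    show "H *\<^sub>v col U i = complex_of_real (d i) \<cdot>\<^sub>v col U i"
      using spectral_eigenvector[OF U HU that] by simp
    show "col U i \<noteq> 0\<^sub>v n"
      using spectral_eigenvector(2)[OF U HU that] by auto
  qed (use U in \<open>auto intro: carrier_vecI\<close>)
  then show ?thesis
    unfolding qform_spectral[OF U(1) HU v] by (auto intro!: sum_nonneg)
qed

lemma hermitian_zero_if_qform_zero:
  assumes H: "H \<in> hermitian_mats n" and q: "\<And>v. v \<in> carrier_vec n \<Longrightarrow> qform H v = 0"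
  shows "H = 0\<^sub>m n n"
proof -
  obtain U d where U: "U \<in> carrier_mat n n" "mat_adjoint U * U = 1\<^sub>m n"
    and HU: "H = U * real_diag n d * mat_adjoint U"
    using spectral_theorem[OF H] by blast
  have "d i = 0" if "i < n" for i
  proof -
    have u: "col U i \<in> carrier_vec n" using U(1) by (auto intro: carrier_vecI)
    have "qform H (col U i) = d i"
      using spectral_eigenvector[OF U HU that] u by (simp add: qform_def)
    with q[OF u] show ?thesis by simp
  qed
  then have "real_diag n d = 0\<^sub>m n n"
    by (intro eq_matI) (auto simp: real_diag_def)
  then show ?thesis using HU U(1) mat_adjoint_carrier[OF U(1)] by simp
qed

section \<open>Inverses and square roots\<close>

text \<open>A one-sided inverse of a square matrix is its inverse, so \<^const>\<open>mat_inverse\<close> must find it. This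
  makes the inverses in the definitions of the means accessible to equational reasoning.\<close>

lemma mat_inverse_eqI:
  fixes A J :: "complex mat"
  assumes A: "A \<in> carrier_mat n n" and J: "J \<in> carrier_mat n n" and AJ: "A * J = 1\<^sub>m n"
  shows "mat_inv A = J" and "J * A = 1\<^sub>m n"
proof -
  show JA: "J * A = 1\<^sub>m n" using mat_mult_left_right_inverse[OF A J AJ] .
  have "A \<in> Units (ring_mat TYPE(complex) n b)" for b :: unit
    using A J AJ JA by (auto simp: Units_def ring_mat_def)
  then obtain K where K: "mat_inverse A = Some K"
    using mat_inverse(1)[OF A, where b = "()"] by (cases "mat_inverse A") auto
  from mat_inverse(2)[OF A this] have "A * K = 1\<^sub>m n" "K * A = 1\<^sub>m n" "K \<in> carrier_mat n n" by auto
  then have "K = J"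
    using A J AJ assoc_mult_mat[of K n n A n J n] by simp
  with K show "mat_inv A = J" by simp
qed

lemma pos_def_inverse:
  assumes P: "P \<in> pos_def_mats n"
  shows "P * mat_inv P = 1\<^sub>m n" "mat_inv P * P = 1\<^sub>m n" "mat_inv P \<in> pos_def_mats n"
proof -
  note Pc = pos_def_carrier[OF P]
  have "det P \<noteq> 0"
  proof
    assume "det P = 0"
    then obtain v where v: "v \<in> carrier_vec n" "v \<noteq> 0\<^sub>v n" "P *\<^sub>v v = 0\<^sub>v n"
      using det_0_iff_vec_prod_zero[OF Pc] by blast
    then have "qform P v = 0" by (simp add: qform_def)
    with pos_def_qform_pos[OF P v(1,2)] show False by simp
  qed
  then obtain J where J: "J \<in> carrier_mat n n" "P * J = 1\<^sub>m n"
    using det_non_zero_imp_unit[OF Pc, of "()"] by (auto simp: Units_def ring_mat_def)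
  note inv = mat_inverse_eqI[OF Pc J]
  show "P * mat_inv P = 1\<^sub>m n" "mat_inv P * P = 1\<^sub>m n" using inv J by auto
  have JP: "mat_adjoint J * P = 1\<^sub>m n"
    using mat_adjoint_mult[OF Pc J(1)] J(2) pos_def_adjoint[OF P] by simp
  have "mat_adjoint J = mat_adjoint J * (P * J)"
    using J mat_adjoint_carrier[OF J(1)] by simp
  also have "\<dots> = J"
    using JP J Pc mat_adjoint_carrier[OF J(1)] assoc_mult_mat[of "mat_adjoint J" n n P n J n] by simp
  finally have adjJ: "mat_adjoint J = J" .
  have "0 < qform J v" if v: "v \<in> carrier_vec n" "v \<noteq> 0\<^sub>v n" for v
  proof -
    have Jv: "J *\<^sub>v v \<in> carrier_vec n" using J v by simp
    have PJv: "P *\<^sub>v (J *\<^sub>v v) = v"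
      using J v Pc assoc_mult_mat_vec[of P n n J n v] by simp
    then have "J *\<^sub>v v \<noteq> 0\<^sub>v n"
      using v Pc by (metis mult_mat_vec_zero)
    from pos_def_qform_pos[OF P Jv this] have "0 < Re (v \<bullet>c (J *\<^sub>v v))"
      by (simp add: qform_def PJv)
    also have "v \<bullet>c (J *\<^sub>v v) = (J *\<^sub>v v) \<bullet>c v"
      using mult_mat_vec_cscalar[OF J(1) v(1) v(1)] adjJ by simp
    finally show ?thesis by (simp add: qform_def)
  qed
  then show "mat_inv P \<in> pos_def_mats n"
    using inv J adjJ by (auto simp: pos_def_mats_iff hermitian_mats_def)
qed

lemma pos_def_congruence:
  assumes P: "P \<in> pos_def_mats n" and M: "M \<in> carrier_mat n n" and N: "N \<in> carrier_mat n n"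
    and NM: "N * M = 1\<^sub>m n"
  shows "mat_adjoint M * P * M \<in> pos_def_mats n"
proof -
  have "0 < qform (mat_adjoint M * P * M) v" if v: "v \<in> carrier_vec n" "v \<noteq> 0\<^sub>v n" for v
  proof -
    have "N *\<^sub>v (M *\<^sub>v v) = v"
      using v M N NM assoc_mult_mat_vec[of N n n M n v] by simp
    then have "M *\<^sub>v v \<noteq> 0\<^sub>v n" using v N by (metis mult_mat_vec_zero)
    then show ?thesis
      using qform_congruence[OF pos_def_carrier[OF P] M v(1)] pos_def_qform_pos[OF P] M v by simp
  qed
  then show ?thesis
    using hermitian_congruence[OF pos_def_hermitian[OF P] M] by (simp add: pos_def_mats_iff)
qed

lemma pos_def_sandwich:
  assumes "P \<in> pos_def_mats n" "S \<in> pos_def_mats n"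
  shows "S * P * S \<in> pos_def_mats n"
  using pos_def_congruence[OF assms(1) pos_def_carrier[OF assms(2)] pos_def_carrier pos_def_inverse(2)]
    assms pos_def_inverse(3)[OF assms(2)] by (simp add: pos_def_adjoint)

lemma pos_def_square:
  assumes "S \<in> pos_def_mats n"
  shows "S * S \<in> pos_def_mats n"
proof -
  have "1\<^sub>m n \<in> pos_def_mats n"
    by (auto simp: pos_def_mats_iff hermitian_mats_def qform_one Re_cscalar_self_pos)
  from pos_def_sandwich[OF this assms] show ?thesis
    using pos_def_carrier[OF assms] by simp
qed

text \<open>Operator monotonicity of the square root. Let \<open>u\<close> be an eigenvector of \<open>C - K\<close> for \<open>\<mu>\<close>. Then
  \<open>K u = C u - \<mu> u\<close>, and expanding \<open>\<parallel>K u\<parallel>\<^sup>2 \<le> \<parallel>C u\<parallel>\<^sup>2\<close> gives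
  \<open>\<mu>\<^sup>2 \<parallel>u\<parallel>\<^sup>2 \<le> 2 \<mu> \<langle>C u, u\<rangle>\<close>, which is impossible for \<open>\<mu> < 0\<close> since \<open>\<langle>C u, u\<rangle> > 0\<close>.\<close>

lemma square_root_monotone:
  assumes C: "C \<in> pos_def_mats n" and K: "K \<in> hermitian_mats n"
    and le: "\<And>v. v \<in> carrier_vec n \<Longrightarrow> qform (K * K) v \<le> qform (C * C) v"
    and v: "v \<in> carrier_vec n"
  shows "qform K v \<le> qform C v"
proof -
  note Cc = pos_def_carrier[OF C] and Kc = hermitian_carrier[OF K]
  have sq: "qform (M * M) u = Re ((M *\<^sub>v u) \<bullet>c (M *\<^sub>v u))"
    if "M \<in> hermitian_mats n" "u \<in> carrier_vec n" for M u
    using qform_congruence[of "1\<^sub>m n" n M n u] that hermitian_carrier[OF that(1)] hermitian_adjoint[OF that(1)]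
    by (simp add: qform_one)
  have "0 \<le> qform (C - K) v"
  proof (rule qform_nonneg_if_eigenvalues_nonneg[OF _ _ v])
    show "C - K \<in> hermitian_mats n" using pos_def_hermitian[OF C] K by (rule hermitian_minus)
    fix \<mu> u assume u: "u \<in> carrier_vec n" "u \<noteq> 0\<^sub>v n"
      and ev: "(C - K) *\<^sub>v u = complex_of_real \<mu> \<cdot>\<^sub>v u"
    have "C *\<^sub>v u - K *\<^sub>v u = complex_of_real \<mu> \<cdot>\<^sub>v u"
      using ev u Cc Kc by (simp add: minus_mult_distrib_mat_vec[of _ n n])
    then have "(C *\<^sub>v u - K *\<^sub>v u) $ i = complex_of_real \<mu> * u $ i" if "i < n" for i
      using that u by simp
    then have Ku: "K *\<^sub>v u = C *\<^sub>v u - complex_of_real \<mu> \<cdot>\<^sub>v u"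
      using u Cc Kc by (intro eq_vecI) (auto simp: algebra_simps)
    have Cu: "C *\<^sub>v u \<in> carrier_vec n" using u Cc by simp
    have sym: "u \<bullet>c (C *\<^sub>v u) = (C *\<^sub>v u) \<bullet>c u"
      using mult_mat_vec_cscalar[OF Cc u(1) u(1)] pos_def_adjoint[OF C] by simp
    have "(K *\<^sub>v u) \<bullet>c (K *\<^sub>v u) = (C *\<^sub>v u) \<bullet>c (C *\<^sub>v u) - complex_of_real (2 * \<mu>) * ((C *\<^sub>v u) \<bullet>c u)
      + complex_of_real (\<mu>\<^sup>2) * (u \<bullet>c u)"
    proof -
      have conj: "conjugate (C *\<^sub>v u - complex_of_real \<mu> \<cdot>\<^sub>v u)
        = conjugate (C *\<^sub>v u) - complex_of_real \<mu> \<cdot>\<^sub>v conjugate u"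
        using u Cc by (intro eq_vecI) auto
      show ?thesis
        unfolding Ku conj using u Cu sym
        by (simp add: minus_scalar_prod_distrib[of _ n] scalar_prod_minus_distrib[of _ n]
            algebra_simps power2_eq_square)
    qed
    then have "qform (K * K) u = qform (C * C) u - 2 * \<mu> * qform C u + \<mu>\<^sup>2 * Re (u \<bullet>c u)"
      using sq[OF K u(1)] sq[OF pos_def_hermitian[OF C] u(1)] by (simp add: qform_def)
    then have "\<mu>\<^sup>2 * Re (u \<bullet>c u) \<le> 2 * \<mu> * qform C u"
      using le[OF u(1)] by simp
    moreover have "0 < qform C u" "0 < Re (u \<bullet>c u)"
      using pos_def_qform_pos[OF C u] Re_cscalar_self_pos[OF u] by auto
    ultimately show "0 \<le> \<mu>"
      by (smt (verit) mult_neg_pos mult_nonneg_nonneg zero_le_power2)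
  qed
  then show ?thesis using qform_minus[OF Cc Kc v] by simp
qed

text \<open>Monotonicity applied in both directions shows that the two roots have the same quadratic form.\<close>

lemma pos_def_square_root_unique:
  assumes S: "S \<in> pos_def_mats n" and T: "T \<in> pos_def_mats n" and eq: "S * S = T * T"
  shows "S = T"
proof -
  note Sc = pos_def_carrier[OF S] and Tc = pos_def_carrier[OF T]
  have "S - T = 0\<^sub>m n n"
  proof (rule hermitian_zero_if_qform_zero)
    show "S - T \<in> hermitian_mats n" using S T by (intro hermitian_minus pos_def_hermitian)
    fix v :: "complex vec" assume v: "v \<in> carrier_vec n"
    have "qform S v = qform T v"
      using square_root_monotone[OF S pos_def_hermitian[OF T] _ v]
        square_root_monotone[OF T pos_def_hermitian[OF S] _ v] eq by fastforce
    then show "qform (S - T) v = 0" using qform_minus[OF Sc Tc v] by simp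
  qed
  then have "(S - T) $$ (i, j) = 0" if "i < n" "j < n" for i j using that by simp
  then show ?thesis using Sc Tc by (intro eq_matI) auto
qed

lemma unitary_conjugation_mult:
  fixes U :: "complex mat"
  assumes U: "U \<in> carrier_mat n n" "mat_adjoint U * U = 1\<^sub>m n"
    and D: "D \<in> carrier_mat n n" and E: "E \<in> carrier_mat n n"
  shows "U * D * mat_adjoint U * (U * E * mat_adjoint U) = U * (D * E) * mat_adjoint U"
proof -
  note U' = mat_adjoint_carrier[OF U(1)]
  have "U * D * mat_adjoint U * (U * E * mat_adjoint U) = U * (D * ((mat_adjoint U * U) * (E * mat_adjoint U)))"
    using U(1) U' D E by (simp add: assoc_mult_mat[of _ n n _ n _ n])
  also have "\<dots> = U * (D * E) * mat_adjoint U"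
    unfolding U(2) using U(1) U' D E by (simp add: assoc_mult_mat[of _ n n _ n _ n])
  finally show ?thesis .
qed

lemma pos_def_square_root_exists:
  assumes P: "P \<in> pos_def_mats n"
  obtains S where "S \<in> pos_def_mats n" "S * S = P"
proof -
  obtain U d where U: "U \<in> carrier_mat n n" "mat_adjoint U * U = 1\<^sub>m n" "U * mat_adjoint U = 1\<^sub>m n"
    and PU: "P = U * real_diag n d * mat_adjoint U"
    using spectral_theorem[OF pos_def_hermitian[OF P]] by blast
  note U' = mat_adjoint_carrier[OF U(1)]
  have d: "0 < d i" if "i < n" for i
  proof -
    have u: "col U i \<in> carrier_vec n" "col U i \<noteq> 0\<^sub>v n"
      using U(1) spectral_eigenvector(2)[OF U(1,2) PU that] by (auto intro: carrier_vecI)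
    have "qform P (col U i) = d i"
      using spectral_eigenvector[OF U(1,2) PU that] u by (simp add: qform_def)
    with pos_def_qform_pos[OF P u] show ?thesis by simp
  qed
  let ?R = "real_diag n (\<lambda>i. sqrt (d i))"
  have R: "?R \<in> pos_def_mats n"
    unfolding pos_def_mats_iff
  proof (intro conjI ballI impI)
    show "?R \<in> hermitian_mats n" by (simp add: hermitian_mats_def)
    fix v :: "complex vec" assume v: "v \<in> carrier_vec n" "v \<noteq> 0\<^sub>v n"
    then obtain i where "i < n" "v $ i \<noteq> 0"
      by (metis carrier_vecD eq_vecI index_zero_vec)
    then show "0 < qform ?R v"
      unfolding qform_real_diag[OF v(1)] using d less_imp_le[OF d]
      by (intro sum_pos2[of _ i]) auto
  qed
  have RR: "?R * ?R = real_diag n d"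
  proof (rule eq_matI)
    fix i j assume "i < dim_row (real_diag n d)" "j < dim_col (real_diag n d)"
    then have ij: "i < n" "j < n" by (auto simp: real_diag_def)
    then show "(?R * ?R) $$ (i, j) = real_diag n d $$ (i, j)"
      using d[OF ij(1)]
      by (auto simp: real_diag_def scalar_prod_def if_distrib[of "\<lambda>x. x * c" for c]
          simp flip: of_real_mult cong: if_cong)
  qed (auto simp: real_diag_def)
  define S where "S = U * ?R * mat_adjoint U"
  have "S \<in> pos_def_mats n"
    using pos_def_congruence[OF R U' U(1,3)] by (simp add: S_def)
  moreover have "S * S = P"
    unfolding S_def PU RR[symmetric]
    using unitary_conjugation_mult[OF U(1,2) pos_def_carrier[OF R] pos_def_carrier[OF R]] .
  ultimately show ?thesis using that by blast
qed

lemma mat_sqrt_eqI: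
  assumes "S \<in> pos_def_mats n" "S * S = P"
  shows "mat_sqrt P = S"
proof -
  have "dim_row P = n" using assms pos_def_carrier by fastforce
  then show ?thesis
    unfolding mat_sqrt_def using assms pos_def_square_root_unique by (intro the_equality) auto
qed

lemma mat_sqrt_pos_def:
  assumes "P \<in> pos_def_mats n"
  shows "mat_sqrt P \<in> pos_def_mats n" "mat_sqrt P * mat_sqrt P = P"
  using pos_def_square_root_exists[OF assms] mat_sqrt_eqI by metis+

lemma mat_sqrt_with_inverse:
  assumes P: "P \<in> pos_def_mats n"
  obtains R K where "R = mat_sqrt P" "K = mat_inv (mat_sqrt P)"
    "R \<in> pos_def_mats n" "K \<in> pos_def_mats n" "R * K = 1\<^sub>m n" "K * R = 1\<^sub>m n"
    "R * R = P" "mat_inv P = K * K"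
proof -
  define R where "R = mat_sqrt P"
  define K where "K = mat_inv R"
  have R: "R \<in> pos_def_mats n" "R * R = P" unfolding R_def using mat_sqrt_pos_def[OF P] by auto
  have K: "R * K = 1\<^sub>m n" "K * R = 1\<^sub>m n" "K \<in> pos_def_mats n"
    unfolding K_def using pos_def_inverse[OF R(1)] by auto
  note c = pos_def_carrier[OF R(1)] pos_def_carrier[OF K(3)]
  note assoc = assoc_mult_mat[of _ n n _ n _ n]
  have "P * (K * K) = R * ((R * K) * K)"
    unfolding R(2)[symmetric] using c by (simp add: assoc)
  then have "P * (K * K) = 1\<^sub>m n" unfolding K(1) using c K(1) by simp
  then have "mat_inv P = K * K"
    using mat_inverse_eqI(1)[OF pos_def_carrier[OF P]] c by simp
  with R K that show ?thesis by (simp add: R_def K_def)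
qed

section \<open>The two means\<close>

text \<open>The Riccati equation \<open>G P\<^sup>-\<^sup>1 G = Q\<close> characterizes \<open>P # Q\<close> among positive definite matrices: with
  \<open>K = P\<^sup>-\<^sup>1\<^sup>/\<^sup>2\<close> it says that the square of \<open>K G K\<close> is \<open>K Q K\<close>, so \<open>K G K\<close> is the square root in the
  definition.\<close>

lemma geometric_mean_eqI:
  assumes P: "P \<in> pos_def_mats n" and G: "G \<in> pos_def_mats n" and ric: "G * mat_inv P * G = Q"
  shows "geometric_mean P Q = G"
proof -
  obtain R K where RK: "R = mat_sqrt P" "K = mat_inv (mat_sqrt P)"
    and R: "R \<in> pos_def_mats n" and K: "K \<in> pos_def_mats n" "R * K = 1\<^sub>m n" "K * R = 1\<^sub>m n"
    and Pinv: "mat_inv P = K * K"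
    by (rule mat_sqrt_with_inverse[OF P])
  note c = pos_def_carrier[OF R] pos_def_carrier[OF K(1)] pos_def_carrier[OF G]
  note assoc = assoc_mult_mat[of _ n n _ n _ n]
  have cancel: "R * (K * M) = M" "K * (R * M) = M" if "M \<in> carrier_mat n n" for M
    using that c K by (simp_all flip: assoc)
  have "K * G * K \<in> pos_def_mats n"
    using pos_def_sandwich[OF G K(1)] .
  moreover have "K * G * K * (K * G * K) = K * Q * K"
    unfolding ric[symmetric] Pinv using c by (simp add: assoc)
  ultimately have "mat_sqrt (K * Q * K) = K * G * K"
    by (rule mat_sqrt_eqI)
  then have "geometric_mean P Q = R * (K * G * K) * R"
    by (simp add: geometric_mean_def RK)
  also have "\<dots> = G"
    using c cancel K by (simp add: assoc)
  finally show ?thesis .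
qed

lemma geometric_mean_riccati:
  assumes P: "P \<in> pos_def_mats n" and Q: "Q \<in> pos_def_mats n"
  shows "geometric_mean P Q \<in> pos_def_mats n"
    "geometric_mean P Q * mat_inv P * geometric_mean P Q = Q"
proof -
  obtain R K where RK: "R = mat_sqrt P" "K = mat_inv (mat_sqrt P)"
    and R: "R \<in> pos_def_mats n" and K: "K \<in> pos_def_mats n" "R * K = 1\<^sub>m n" "K * R = 1\<^sub>m n"
    and Pinv: "mat_inv P = K * K"
    by (rule mat_sqrt_with_inverse[OF P])
  define C where "C = mat_sqrt (K * Q * K)"
  have C: "C \<in> pos_def_mats n" "C * C = K * Q * K"
    unfolding C_def using mat_sqrt_pos_def[OF pos_def_sandwich[OF Q K(1)]] by auto
  note c = pos_def_carrier[OF R] pos_def_carrier[OF K(1)] pos_def_carrier[OF Q] pos_def_carrier[OF C(1)]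
  note assoc = assoc_mult_mat[of _ n n _ n _ n]
  have cancel: "R * (K * M) = M" "K * (R * M) = M" if "M \<in> carrier_mat n n" for M
    using that c K by (simp_all flip: assoc)
  have gm: "geometric_mean P Q = R * C * R"
    by (simp add: geometric_mean_def RK C_def)
  show "geometric_mean P Q \<in> pos_def_mats n"
    unfolding gm using pos_def_sandwich[OF C(1) R] .
  have "R * C * R * (K * K) * (R * C * R) = R * (C * C) * R"
    using c cancel by (simp add: assoc)
  also have "\<dots> = Q"
    unfolding C(2) using c cancel K by (simp add: assoc)
  finally show "geometric_mean P Q * mat_inv P * geometric_mean P Q = Q"
    unfolding gm Pinv .
qed

text \<open>The extremal property of the geometric mean, and the source of lower bounds for it that avoid
  computing square roots. After conjugation with \<open>K = P\<^sup>-\<^sup>1\<^sup>/\<^sup>2\<close> the hypothesis becomes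
  \<open>(K Z K)\<^sup>2 \<le> (K G K)\<^sup>2\<close> for \<open>G = P # Q\<close>, and the square root is monotone.\<close>

lemma geometric_mean_maximal:
  assumes P: "P \<in> pos_def_mats n" and Q: "Q \<in> pos_def_mats n" and Z: "Z \<in> hermitian_mats n"
    and le: "\<And>v. v \<in> carrier_vec n \<Longrightarrow> qform (Z * mat_inv P * Z) v \<le> qform Q v"
    and v: "v \<in> carrier_vec n"
  shows "qform Z v \<le> qform (geometric_mean P Q) v"
proof -
  define G where "G = geometric_mean P Q"
  have G: "G \<in> pos_def_mats n" "G * mat_inv P * G = Q"
    unfolding G_def using geometric_mean_riccati[OF P Q] by auto
  obtain R K where RK: "R = mat_sqrt P" "K = mat_inv (mat_sqrt P)"
    and R: "R \<in> pos_def_mats n" and K: "K \<in> pos_def_mats n" "R * K = 1\<^sub>m n" "K * R = 1\<^sub>m n"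
    and Pinv: "mat_inv P = K * K"
    by (rule mat_sqrt_with_inverse[OF P])
  note c = pos_def_carrier[OF R] pos_def_carrier[OF K(1)] pos_def_carrier[OF Q] pos_def_carrier[OF G(1)]
    hermitian_carrier[OF Z]
  note assoc = assoc_mult_mat[of _ n n _ n _ n]
  have cancel: "R * (K * M) = M" "K * (R * M) = M" if "M \<in> carrier_mat n n" for M
    using that c K by (simp_all flip: assoc)
  have q: "qform (K * M * K) w = qform M (K *\<^sub>v w)" if "M \<in> carrier_mat n n" "w \<in> carrier_vec n" for M w
    using qform_congruence[OF that(1) c(2) that(2)] pos_def_adjoint[OF K(1)] by simp
  have sq: "K * M * K * (K * M * K) = K * (M * mat_inv P * M) * K" if "M \<in> carrier_mat n n" for M
    unfolding Pinv using that c by (simp add: assoc)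
  have mono: "qform (K * Z * K) w \<le> qform (K * G * K) w" if w: "w \<in> carrier_vec n" for w
  proof (rule square_root_monotone[OF _ _ _ w])
    show "K * G * K \<in> pos_def_mats n" using pos_def_sandwich[OF G(1) K(1)] .
    show "K * Z * K \<in> hermitian_mats n"
      using hermitian_congruence[OF Z c(2)] pos_def_adjoint[OF K(1)] by simp
    fix u :: "complex vec" assume u: "u \<in> carrier_vec n"
    have "Z * mat_inv P * Z \<in> carrier_mat n n" unfolding Pinv using c by (simp add: mult_carrier_mat[of _ n n])
    then show "qform (K * Z * K * (K * Z * K)) u \<le> qform (K * G * K * (K * G * K)) u"
      unfolding sq[OF c(4)] sq[OF c(5)] G(2)
      using q[OF _ u] q[OF c(3) u] le[of "K *\<^sub>v u"] c u by (simp del: assoc_mult_mat)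
  qed
  have "K *\<^sub>v (R *\<^sub>v v) = v"
    using c v K by (simp flip: assoc_mult_mat_vec[of _ n n _ n])
  then show ?thesis
    using mono[of "R *\<^sub>v v"] q[OF c(4), of "R *\<^sub>v v"] q[OF c(5), of "R *\<^sub>v v"] c v
    by (simp add: G_def del: assoc_mult_mat)
qed

text \<open>The maximality of the geometric mean for \<open>Z = X W X\<close> and \<open>B = X A X\<close>: conjugating
  \<open>Z A\<^sup>-\<^sup>1 Z \<le> B\<close> with \<open>X\<^sup>-\<^sup>1\<close> leaves \<open>W X A\<^sup>-\<^sup>1 X W \<le> A\<close>. When \<open>X\<close> is nearly singular this form is
  far better conditioned, so that a \<open>W\<close> with small entries suffices.\<close>

lemma geometric_mean_sandwich_ge:
  assumes A: "A \<in> pos_def_mats n" and X: "X \<in> pos_def_mats n" and W: "W \<in> hermitian_mats n"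
    and bound: "A - W * X * mat_inv A * X * W \<in> pos_def_mats n" and v: "v \<in> carrier_vec n"
  shows "qform (X * W * X) v \<le> qform (geometric_mean A (X * A * X)) v"
proof (rule geometric_mean_maximal[OF A pos_def_sandwich[OF A X] _ _ v])
  let ?J = "mat_inv A"
  note c = pos_def_carrier[OF X] pos_def_carrier[OF A] hermitian_carrier[OF W]
    pos_def_carrier[OF pos_def_inverse(3)[OF A]]
  note Xadj = pos_def_adjoint[OF X]
  show "X * W * X \<in> hermitian_mats n"
    using hermitian_congruence[OF W c(1)] Xadj by simp
  define V where "V = W * X * ?J * X * W"
  have Vc: "V \<in> carrier_mat n n" unfolding V_def using c by (intro mult_carrier_mat[of _ n n]; simp)
  fix u :: "complex vec" assume u: "u \<in> carrier_vec n"
  have Xu: "X *\<^sub>v u \<in> carrier_vec n" using c u by simp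
  have "X * W * X * ?J * (X * W * X) = X * V * X"
    unfolding V_def using c by (simp add: assoc_mult_mat[of _ n n _ n _ n] mult_carrier_mat[of _ n n])
  then have "qform (X * W * X * ?J * (X * W * X)) u = qform V (X *\<^sub>v u)"
    using qform_congruence[OF Vc c(1) u] Xadj by simp
  also have "\<dots> \<le> qform A (X *\<^sub>v u)"
    using pos_def_qform_nonneg[OF bound Xu] qform_minus[OF c(2) Vc Xu] by (simp add: V_def)
  also have "\<dots> = qform (X * A * X) u"
    using qform_congruence[OF c(2) c(1) u] Xadj by simp
  finally show "qform (X * W * X * ?J * (X * W * X)) u \<le> qform (X * A * X) u" .
qed

text \<open>If \<open>B = S\<^sup>2 A S\<^sup>2\<close>, then \<open>S\<^sup>2\<close> solves the Riccati equation that defines \<open>A\<^sup>-\<^sup>1 # B\<close>, so the square root of that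
  mean is \<open>S\<close>. Pairs given by \<open>A\<close> and \<open>S\<close> therefore have an explicit spectral mean.\<close>

lemma spectral_geometric_mean_eqI:
  assumes A: "A \<in> pos_def_mats n" and S: "S \<in> pos_def_mats n"
  shows "spectral_geometric_mean A (S * S * A * (S * S)) = S * A * S"
proof -
  note inv = pos_def_inverse[OF A]
  have "mat_inv (mat_inv A) = A"
    using mat_inverse_eqI(1)[OF pos_def_carrier[OF inv(3)] pos_def_carrier[OF A] inv(2)] .
  then have "geometric_mean (mat_inv A) (S * S * A * (S * S)) = S * S"
    using geometric_mean_eqI[OF inv(3) pos_def_square[OF S]] by simp
  then show ?thesis
    by (simp add: spectral_geometric_mean_def mat_sqrt_eqI[OF S refl])
qed

section \<open>Traces\<close>

definition mat_trace :: "complex mat \<Rightarrow> complex" where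
  "mat_trace A = (\<Sum>i<dim_row A. A $$ (i, i))"

lemma mat_trace_add:
  "A \<in> carrier_mat n n \<Longrightarrow> B \<in> carrier_mat n n \<Longrightarrow> mat_trace (A + B) = mat_trace A + mat_trace B"
  by (simp add: mat_trace_def sum.distrib)

lemma mat_trace_smult: "A \<in> carrier_mat n n \<Longrightarrow> mat_trace (c \<cdot>\<^sub>m A) = c * mat_trace A"
  by (simp add: mat_trace_def sum_distrib_left)

lemma mat_trace_minus:
  "A \<in> carrier_mat n n \<Longrightarrow> B \<in> carrier_mat n n \<Longrightarrow> mat_trace (A - B) = mat_trace A - mat_trace B"
  by (simp add: mat_trace_def sum_subtractf)

lemma mat_trace_mult_commute:
  assumes "A \<in> carrier_mat n m" "B \<in> carrier_mat m n"
  shows "mat_trace (A * B) = mat_trace (B * A)"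
proof -
  have "mat_trace (A * B) = (\<Sum>i<n. \<Sum>j<m. A $$ (i, j) * B $$ (j, i))"
    using assms by (auto simp: mat_trace_def scalar_prod_def atLeast0LessThan intro!: sum.cong)
  also have "\<dots> = (\<Sum>j<m. \<Sum>i<n. A $$ (i, j) * B $$ (j, i))"
    by (rule sum.swap)
  also have "\<dots> = mat_trace (B * A)"
    using assms by (auto simp: mat_trace_def scalar_prod_def atLeast0LessThan mult.commute intro!: sum.cong)
  finally show ?thesis .
qed

lemma conjugate_unit_vec: "conjugate (unit_vec n i) = (unit_vec n i :: complex vec)"
  by (intro eq_vecI) (auto simp: unit_vec_def)

text \<open>The diagonal entries are the values of the quadratic form of \<open>P\<close> at the columns of \<open>M\<close>.\<close>

lemma mat_trace_congruence_pos:
  assumes P: "P \<in> pos_def_mats n" and M: "M \<in> carrier_mat n n" and ne: "M \<noteq> 0\<^sub>m n n"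
  shows "0 < Re (mat_trace (mat_adjoint M * P * M))"
proof -
  note Pc = pos_def_carrier[OF P] and M' = mat_adjoint_carrier[OF M]
  have colM: "col M j \<in> carrier_vec n" for j using M by (auto intro: carrier_vecI)
  have "Re ((mat_adjoint M * P * M) $$ (j, j)) = qform P (col M j)" if j: "j < n" for j
  proof -
    have MPM: "mat_adjoint M * P * M \<in> carrier_mat n n" using M M' Pc by simp
    have "qform (mat_adjoint M * P * M) (unit_vec n j) = Re ((mat_adjoint M * P * M) $$ (j, j))"
      using j MPM unfolding qform_def mat_mult_unit_vec[OF MPM j]
      by (simp add: conjugate_unit_vec del: index_mult_mat)
    then show ?thesis
      using qform_congruence[OF Pc M, of "unit_vec n j"] mat_mult_unit_vec[OF M j] by simp
  qed
  then have "Re (mat_trace (mat_adjoint M * P * M)) = (\<Sum>j<n. qform P (col M j))"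
    using M by (simp add: mat_trace_def del: index_mult_mat(1))
  also obtain i j where "i < n" "j < n" "M $$ (i, j) \<noteq> 0"
    using ne M by (metis eq_matI carrier_matD index_zero_mat zero_carrier_mat)
  then have "j < n" "col M j \<noteq> 0\<^sub>v n" using M by (auto dest!: arg_cong[of _ _ "\<lambda>v. v $ i"])
  then have "0 < (\<Sum>j<n. qform P (col M j))"
    using pos_def_qform_nonneg[OF P colM] pos_def_qform_pos[OF P colM] by (intro sum_pos2[of _ j]) auto
  finally show ?thesis .
qed

text \<open>Let \<open>G\<close> be the geometric mean and \<open>M = A S - G S\<^sup>-\<^sup>1\<close>. Expanding, and using \<open>G A\<^sup>-\<^sup>1 G = S\<^sup>2 A S\<^sup>2\<close> for the
  last term, gives
  \<open>M\<^sup>* A\<^sup>-\<^sup>1 M = S A S - S G S\<^sup>-\<^sup>1 - S\<^sup>-\<^sup>1 G S + S A S\<close>, whose trace is \<open>2 tr (S A S) - 2 tr G\<close> because the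
  trace is invariant under conjugation. It is positive unless \<open>M = 0\<close>, and \<open>M = 0\<close> means that
  \<open>A S\<^sup>2 = G\<close> is Hermitian, that is, \<open>A\<close> commutes with \<open>S\<^sup>2\<close>.\<close>

lemma trace_geometric_mean_less:
  assumes A: "A \<in> pos_def_mats n" and S: "S \<in> pos_def_mats n"
    and ne: "A * (S * S) \<noteq> S * S * A"
  shows "Re (mat_trace (geometric_mean A (S * S * A * (S * S)))) < Re (mat_trace (S * A * S))"
proof -
  define G where "G = geometric_mean A (S * S * A * (S * S))"
  define J where "J = mat_inv A"
  define T where "T = mat_inv S"
  have B: "S * S * A * (S * S) \<in> pos_def_mats n"
    using pos_def_sandwich[OF A pos_def_square[OF S]] .
  have G: "G \<in> pos_def_mats n" "G * J * G = S * S * A * (S * S)"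
    unfolding G_def J_def using geometric_mean_riccati[OF A B] by auto
  have J: "A * J = 1\<^sub>m n" "J * A = 1\<^sub>m n" "J \<in> pos_def_mats n"
    unfolding J_def using pos_def_inverse[OF A] by auto
  have T: "S * T = 1\<^sub>m n" "T * S = 1\<^sub>m n" "T \<in> pos_def_mats n"
    unfolding T_def using pos_def_inverse[OF S] by auto
  note c = pos_def_carrier[OF A] pos_def_carrier[OF S] pos_def_carrier[OF G(1)]
    pos_def_carrier[OF J(3)] pos_def_carrier[OF T(3)]
  note assoc = assoc_mult_mat[of _ n n _ n _ n]
  have cancel: "S * (T * N) = N" "T * (S * N) = N" "A * (J * N) = N" "J * (A * N) = N"
    if "N \<in> carrier_mat n n" for N
    using that c T J by (simp_all flip: assoc)
  define M where "M = A * S - G * T"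
  have Mc: "M \<in> carrier_mat n n" using c unfolding M_def by (intro minus_carrier_mat mult_carrier_mat[of _ n n])
  have adjM: "mat_adjoint M = S * A - T * G"
    unfolding M_def using c pos_def_adjoint A S T G
    by (simp add: mat_adjoint_minus[of _ n n] mat_adjoint_mult[of _ n n _ n])
  have "M \<noteq> 0\<^sub>m n n"
  proof
    assume "M = 0\<^sub>m n n"
    then have "(A * S - G * T) $$ (i, j) = 0" if "i < n" "j < n" for i j
      using that by (simp add: M_def)
    then have "A * S = G * T" using c by (intro eq_matI) auto
    then have "A * S * S = G * T * S" by simp
    then have *: "A * (S * S) = G" using c T by (simp add: assoc)
    then have "mat_adjoint (A * (S * S)) = A * (S * S)" using pos_def_adjoint[OF G(1)] by simp
    then show False
      using ne c pos_def_adjoint[OF A] pos_def_adjoint[OF S] by (simp add: mat_adjoint_mult[of _ n n _ n])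
  qed
  then have "0 < Re (mat_trace (mat_adjoint M * J * M))"
    by (rule mat_trace_congruence_pos[OF J(3) Mc])
  also have "mat_adjoint M * J * M = (S * A * S - S * G * T) - (T * G * S - T * (G * J * G) * T)"
  proof -
    have p: "A * S \<in> carrier_mat n n" "G * T \<in> carrier_mat n n" "S * A \<in> carrier_mat n n"
      "T * G \<in> carrier_mat n n" "J * (G * T) \<in> carrier_mat n n"
      using c by (intro mult_carrier_mat[of _ n n]; simp)+
    have JM: "J * M = S - J * (G * T)"
      unfolding M_def using mult_minus_distrib_mat[OF c(4) p(1,2)] c cancel by simp
    have "mat_adjoint M * J * M = (S * A - T * G) * (S - J * (G * T))"
      using assoc[OF mat_adjoint_carrier[OF Mc] c(4) Mc] by (simp only: JM adjM)
    also have "\<dots> = S * A * (S - J * (G * T)) - T * G * (S - J * (G * T))"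
      using minus_mult_distrib_mat[OF p(3,4) minus_carrier_mat[OF p(5), of S]] .
    also have "\<dots> = (S * A * S - S * A * (J * (G * T))) - (T * G * S - T * G * (J * (G * T)))"
      using mult_minus_distrib_mat[OF p(3) c(2) p(5)] mult_minus_distrib_mat[OF p(4) c(2) p(5)] by simp
    also have "\<dots> = (S * A * S - S * G * T) - (T * G * S - T * (G * J * G) * T)"
      using c p cancel by (simp add: assoc)
    finally show ?thesis .
  qed
  also have "T * (G * J * G) * T = S * A * S"
    unfolding G(2) using c cancel T by (simp add: assoc)
  also have "mat_trace ((S * A * S - S * G * T) - (T * G * S - S * A * S))
    = 2 * mat_trace (S * A * S) - mat_trace (S * G * T) - mat_trace (T * G * S)"
  proof -
    have p: "S * A * S \<in> carrier_mat n n" "S * G * T \<in> carrier_mat n n" "T * G * S \<in> carrier_mat n n"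
      using c by (intro mult_carrier_mat[of _ n n]; simp)+
    show ?thesis
      using mat_trace_minus[OF minus_carrier_mat[OF p(2), of "S * A * S"] minus_carrier_mat[OF p(1), of "T * G * S"]]
        mat_trace_minus[OF p(1,2)] mat_trace_minus[OF p(3,1)] by simp
  qed
  also have "mat_trace (S * G * T) = mat_trace G"
    using mat_trace_mult_commute[of "S * G" n n T] c cancel by (simp add: assoc)
  also have "mat_trace (T * G * S) = mat_trace G"
    using mat_trace_mult_commute[of "T * G" n n S] c cancel by (simp add: assoc)
  finally show ?thesis by (simp add: G_def)
qed

section \<open>Eigenvalue lists and weak majorization\<close>

text \<open>Links the eigenvalue list, defined through roots of the characteristic polynomial, to a
  diagonalization; multiplicities agree because similar matrices have the same characteristic
  polynomial.\<close>

lemma eigenvalues_desc_spectral: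
  assumes U: "U \<in> carrier_mat n n" "mat_adjoint U * U = 1\<^sub>m n" "U * mat_adjoint U = 1\<^sub>m n"
    and A: "A = U * real_diag n d * mat_adjoint U"
  shows "eigenvalues_desc A = rev (sort (map d [0..<n]))"
proof -
  note U' = mat_adjoint_carrier[OF U(1)]
  have "similar_mat_wit A (real_diag n d) U (mat_adjoint U)"
    using similar_mat_witI[OF U(3,2) A _ real_diag_carrier U(1) U'] mult_carrier_mat[OF mult_carrier_mat[OF U(1) real_diag_carrier[of n d]] U']
    by (simp only: A[symmetric])
  then have "char_poly A = char_poly (real_diag n d)"
    by (intro char_poly_similar) (auto simp: similar_mat_def)
  also have "\<dots> = (\<Prod>a\<leftarrow>diag_mat (real_diag n d). [:- a, 1:])"
    by (rule char_poly_upper_triangular[of _ n]) (auto simp: real_diag_def)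
  also have "diag_mat (real_diag n d) = map (\<lambda>i. complex_of_real (d i)) [0..<n]"
    by (auto simp: diag_mat_def real_diag_def)
  finally have cp: "char_poly A = (\<Prod>i\<leftarrow>[0..<n]. [:- complex_of_real (d i), 1:])"
    by (simp add: o_def)
  have "proots (\<Prod>i\<leftarrow>xs. [:- complex_of_real (d i), 1:]) = mset (map (\<lambda>i. complex_of_real (d i)) xs)" for xs :: "nat list"
  proof (induction xs)
    case (Cons x xs)
    have "(\<Prod>i\<leftarrow>xs. [:- complex_of_real (d i), 1:]) \<noteq> 0"
      by (auto simp: prod_list_zero_iff)
    with Cons show ?case by (simp add: proots_mult del: mult_pCons_left)
  qed simp
  then have "image_mset Re (proots (char_poly A)) = mset (map d [0..<n])"
    unfolding cp by (simp add: image_mset.compositionality o_def del: upt.simps)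
  then show ?thesis
    by (simp only: eigenvalues_desc_def sorted_list_of_multiset_mset)
qed

lemma length_eigenvalues_desc:
  assumes "A \<in> hermitian_mats n"
  shows "length (eigenvalues_desc A) = n"
proof -
  obtain U d where U: "U \<in> carrier_mat n n" "mat_adjoint U * U = 1\<^sub>m n" "U * mat_adjoint U = 1\<^sub>m n"
    and A: "A = U * real_diag n d * mat_adjoint U"
    using spectral_theorem[OF assms] by blast
  show ?thesis unfolding eigenvalues_desc_spectral[OF U A] by simp
qed

lemma sum_eigenvalues_desc:
  assumes "A \<in> hermitian_mats n"
  shows "sum_list (eigenvalues_desc A) = Re (mat_trace A)"
proof -
  obtain U d where U: "U \<in> carrier_mat n n" "mat_adjoint U * U = 1\<^sub>m n" "U * mat_adjoint U = 1\<^sub>m n"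
    and A: "A = U * real_diag n d * mat_adjoint U"
    using spectral_theorem[OF assms] by blast
  note U' = mat_adjoint_carrier[OF U(1)]
  have "mat_trace A = mat_trace (mat_adjoint U * (U * real_diag n d))"
    unfolding A using U(1) U' by (intro mat_trace_mult_commute[of _ n n]) auto
  also have "mat_adjoint U * (U * real_diag n d) = real_diag n d"
    using U U' assoc_mult_mat[OF U' U(1) real_diag_carrier[of n d]]
      left_mult_one_mat[OF real_diag_carrier[of n d]] by simp
  finally have "Re (mat_trace A) = (\<Sum>i<n. d i)"
    by (simp add: mat_trace_def real_diag_def)
  also have "\<dots> = sum_list (map d [0..<n])"
    by (simp add: interv_sum_list_conv_sum_set_nat atLeast0LessThan)
  also have "\<dots> = sum_list (eigenvalues_desc A)"
    unfolding eigenvalues_desc_spectral[OF U A]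
    by (metis mset_rev mset_sort sum_mset_sum_list)
  finally show ?thesis ..
qed

text \<open>Together with the next lemma this is the Rayleigh characterization of the largest eigenvalue,
  which bounds it from below by a test vector and from above by an operator inequality.\<close>

lemma qform_le_Max_eigenvalues:
  assumes "A \<in> hermitian_mats n" and v: "v \<in> carrier_vec n"
  shows "qform A v \<le> Max (set (eigenvalues_desc A)) * Re (v \<bullet>c v)"
proof -
  obtain U d where U: "U \<in> carrier_mat n n" "mat_adjoint U * U = 1\<^sub>m n" "U * mat_adjoint U = 1\<^sub>m n"
    and A: "A = U * real_diag n d * mat_adjoint U"
    using spectral_theorem[OF assms(1)] by blast
  note U' = mat_adjoint_carrier[OF U(1)]
  have w: "mat_adjoint U *\<^sub>v v \<in> carrier_vec n" using U' v by simp
  have "d i \<le> Max (set (eigenvalues_desc A))" if "i < n" for i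
    using that unfolding eigenvalues_desc_spectral[OF U A] by simp
  then have "qform A v \<le> (\<Sum>i<n. Max (set (eigenvalues_desc A)) * (cmod ((mat_adjoint U *\<^sub>v v) $ i))\<^sup>2)"
    unfolding qform_spectral[OF U(1) A v] by (intro sum_mono mult_right_mono) auto
  also have "\<dots> = Max (set (eigenvalues_desc A)) * Re (v \<bullet>c v)"
    using arg_cong[OF cscalar_self[OF w], of Re] unfolding unitary_norm[OF U(1,3) v]
    by (simp add: sum_distrib_left)
  finally show ?thesis .
qed

lemma Max_eigenvalues_le:
  assumes "A \<in> hermitian_mats n" "n \<noteq> 0"
    and le: "\<And>v. v \<in> carrier_vec n \<Longrightarrow> qform A v \<le> c * Re (v \<bullet>c v)"
  shows "Max (set (eigenvalues_desc A)) \<le> c"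
proof -
  obtain U d where U: "U \<in> carrier_mat n n" "mat_adjoint U * U = 1\<^sub>m n" "U * mat_adjoint U = 1\<^sub>m n"
    and A: "A = U * real_diag n d * mat_adjoint U"
    using spectral_theorem[OF assms(1)] by blast
  have "d i \<le> c" if "i < n" for i
  proof -
    have u: "col U i \<in> carrier_vec n" using U(1) by (auto intro: carrier_vecI)
    show ?thesis
      using le[OF u] spectral_eigenvector[OF U(1,2) A that] u by (simp add: qform_def)
  qed
  then show ?thesis
    unfolding eigenvalues_desc_spectral[OF U A] using assms(2) by (subst Max_le_iff) auto
qed

text \<open>The case \<open>k = 1\<close> of weak majorization.\<close>

lemma weakly_majorized_Max_le:
  assumes "x \<prec>\<^sub>w y" "x \<noteq> []"
  shows "Max (set x) \<le> Max (set y)"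
proof -
  have top: "sum_list (take 1 (rev (sort z))) = Max (set z)" if "z \<noteq> []" for z :: "real list"
  proof -
    have "sort z \<noteq> []" using that by (metis length_0_conv length_sort)
    then obtain a zs where zs: "rev (sort z) = a # zs"
      by (metis neq_Nil_conv rev_is_Nil_conv)
    then have "sort z = rev zs @ [a]" by (metis rev.simps(2) rev_rev_ident)
    moreover have "sorted (sort z)" by simp
    ultimately have "\<forall>b\<in>set zs. b \<le> a" by (simp add: sorted_append)
    moreover have "set z = insert a (set zs)" using zs by (metis list.set(2) set_rev set_sort)
    ultimately have "Max (set z) = a" by (intro Max_eqI) auto
    with zs show ?thesis by simp
  qed
  have "length x = length y" "1 \<le> length x"
    using assms by (auto simp: weakly_majorized_def Suc_le_eq)
  then have "y \<noteq> []" "sum_list (take 1 (rev (sort x))) \<le> sum_list (take 1 (rev (sort y)))"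
    using assms(1) unfolding weakly_majorized_def by (fastforce, metis atLeastAtMost_iff le_refl)
  then show ?thesis using top assms(2) by simp
qed

text \<open>The case in which \<open>k\<close> is the full length.\<close>

lemma weakly_majorized_sum_list_le:
  assumes "x \<prec>\<^sub>w y"
  shows "sum_list x \<le> sum_list y"
proof -
  have "sum_list (rev (sort z)) = sum_list z" for z :: "real list"
    by (metis mset_rev mset_sort sum_mset_sum_list)
  moreover have "sum_list (take (length x) (rev (sort x))) \<le> sum_list (take (length x) (rev (sort y)))"
  proof (cases "x = []")
    case False
    then have "length x \<in> {1..length x}" by (simp add: Suc_le_eq)
    then show ?thesis using assms unfolding weakly_majorized_def by blast
  qed (use assms in \<open>auto simp: weakly_majorized_def\<close>)
  ultimately show ?thesis
    using assms by (simp add: weakly_majorized_def)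
qed

section \<open>The trace comparison of the Heron expressions\<close>

lemma heron_hermitian:
  assumes "A \<in> pos_def_mats n" "B \<in> pos_def_mats n" "G \<in> pos_def_mats n"
  shows "A + B + 2 \<cdot>\<^sub>m G \<in> hermitian_mats n"
  using assms by (intro hermitian_add hermitian_smult pos_def_hermitian) auto

lemma trace_heron:
  assumes "A \<in> pos_def_mats n" "B \<in> pos_def_mats n" "G \<in> pos_def_mats n"
  shows "Re (mat_trace (A + B + 2 \<cdot>\<^sub>m G)) = Re (mat_trace A) + Re (mat_trace B) + 2 * Re (mat_trace G)"
  using assms[THEN pos_def_carrier] by (simp add: mat_trace_add[of _ n] mat_trace_smult[of _ n])

text \<open>For \<open>k = n\<close> weak majorization compares traces, and \<open>A + B\<close> contributes equally to both.\<close>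

lemma spectral_heron_not_weakly_majorized:
  assumes A: "A \<in> pos_def_mats n" and S: "S \<in> pos_def_mats n"
    and ne: "A * (S * S) \<noteq> S * S * A" and B: "B = S * S * A * (S * S)"
  shows "\<not> eigenvalues_desc (A + B + 2 \<cdot>\<^sub>m spectral_geometric_mean A B)
    \<prec>\<^sub>w eigenvalues_desc (A + B + 2 \<cdot>\<^sub>m geometric_mean A B)"
proof
  have Bp: "B \<in> pos_def_mats n"
    unfolding B using pos_def_sandwich[OF A pos_def_square[OF S]] .
  have N: "spectral_geometric_mean A B = S * A * S" "S * A * S \<in> pos_def_mats n"
    unfolding B using spectral_geometric_mean_eqI[OF A S] pos_def_sandwich[OF A S] by auto
  note G = geometric_mean_riccati(1)[OF A Bp]
  assume "eigenvalues_desc (A + B + 2 \<cdot>\<^sub>m spectral_geometric_mean A B)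
    \<prec>\<^sub>w eigenvalues_desc (A + B + 2 \<cdot>\<^sub>m geometric_mean A B)"
  from weakly_majorized_sum_list_le[OF this]
  have "Re (mat_trace (S * A * S)) \<le> Re (mat_trace (geometric_mean A B))"
    unfolding N(1) sum_eigenvalues_desc[OF heron_hermitian[OF A Bp N(2)]]
      sum_eigenvalues_desc[OF heron_hermitian[OF A Bp G]]
      trace_heron[OF A Bp N(2)] trace_heron[OF A Bp G] by simp
  then show False
    using trace_geometric_mean_less[OF A S ne] unfolding B by simp
qed

section \<open>Symmetric real matrices of size three\<close>

text \<open>Entries are listed row by row. Real entries let the arithmetic of the example be carried out over
  the rationals inside the real numbers.\<close>

definition real_mat3 :: "real list \<Rightarrow> complex mat" where
  "real_mat3 xs = mat 3 3 (\<lambda>(i, j). complex_of_real (xs ! (3 * i + j)))"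

lemma real_mat3_carrier: "real_mat3 xs \<in> carrier_mat 3 3"
  by (simp add: real_mat3_def)

lemma less_3_cases: "i < 3 \<longleftrightarrow> i = 0 \<or> i = 1 \<or> i = (2::nat)"
  by auto

lemma sum_lessThan_3: "(\<Sum>i<3. f i) = f 0 + f 1 + f (2::nat)"
  for f :: "nat \<Rightarrow> 'a::comm_monoid_add"
  by (simp add: numeral_3_eq_3 numeral_2_eq_2)

lemma real_mat3_mult:
  "real_mat3 [a, b, c, d, e, f, g, h, i] * real_mat3 [a', b', c', d', e', f', g', h', i'] = real_mat3
    [a * a' + b * d' + c * g', a * b' + b * e' + c * h', a * c' + b * f' + c * i',
     d * a' + e * d' + f * g', d * b' + e * e' + f * h', d * c' + e * f' + f * i',
     g * a' + h * d' + i * g', g * b' + h * e' + i * h', g * c' + h * f' + i * i']"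
  by (rule eq_matI)
     (auto simp: real_mat3_def scalar_prod_def less_3_cases sum_lessThan_3 atLeast0LessThan)

lemma real_mat3_add:
  "real_mat3 [a, b, c, d, e, f, g, h, i] + real_mat3 [a', b', c', d', e', f', g', h', i'] = real_mat3
    [a + a', b + b', c + c', d + d', e + e', f + f', g + g', h + h', i + i']"
  by (rule eq_matI) (auto simp: real_mat3_def less_3_cases)

lemma real_mat3_minus:
  "real_mat3 [a, b, c, d, e, f, g, h, i] - real_mat3 [a', b', c', d', e', f', g', h', i'] = real_mat3
    [a - a', b - b', c - c', d - d', e - e', f - f', g - g', h - h', i - i']"
  by (rule eq_matI) (auto simp: real_mat3_def less_3_cases)

lemma real_mat3_smult:
  "complex_of_real r \<cdot>\<^sub>m real_mat3 [a, b, c, d, e, f, g, h, i] = real_mat3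
    [r * a, r * b, r * c, r * d, r * e, r * f, r * g, r * h, r * i]"
  by (rule eq_matI) (auto simp: real_mat3_def less_3_cases)

lemma real_mat3_one: "1\<^sub>m 3 = real_mat3 [1, 0, 0, 0, 1, 0, 0, 0, 1]"
  by (rule eq_matI) (auto simp: real_mat3_def less_3_cases)

lemma real_mat3_hermitian: "real_mat3 [a, b, c, b, d, e, c, e, f] \<in> hermitian_mats 3"
  unfolding hermitian_mats_def
  by (auto simp: real_mat3_def less_3_cases intro!: eq_matI)

definition ternary_form :: "real list \<Rightarrow> real \<Rightarrow> real \<Rightarrow> real \<Rightarrow> real" where
  "ternary_form m x y z = m ! 0 * x\<^sup>2 + m ! 4 * y\<^sup>2 + m ! 8 * z\<^sup>2
     + 2 * m ! 1 * x * y + 2 * m ! 2 * x * z + 2 * m ! 5 * y * z"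

text \<open>A real symmetric matrix does not mix the real and the imaginary part of a complex vector.\<close>

lemma qform_real_mat3:
  assumes "v \<in> carrier_vec 3"
  shows "qform (real_mat3 [a, b, c, b, d, e, c, e, f]) v =
    ternary_form [a, b, c, b, d, e, c, e, f] (Re (v $ 0)) (Re (v $ 1)) (Re (v $ 2))
    + ternary_form [a, b, c, b, d, e, c, e, f] (Im (v $ 0)) (Im (v $ 1)) (Im (v $ 2))"
proof -
  have idx: "(real_mat3 [a, b, c, b, d, e, c, e, f] *\<^sub>v v) $ 0 = a * v $ 0 + b * v $ 1 + c * v $ 2"
    "(real_mat3 [a, b, c, b, d, e, c, e, f] *\<^sub>v v) $ 1 = b * v $ 0 + d * v $ 1 + e * v $ 2"
    "(real_mat3 [a, b, c, b, d, e, c, e, f] *\<^sub>v v) $ 2 = c * v $ 0 + e * v $ 1 + f * v $ 2"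
    using assms by (simp_all add: real_mat3_def scalar_prod_def sum_lessThan_3 atLeast0LessThan)
  have "qform (real_mat3 [a, b, c, b, d, e, c, e, f]) v
    = Re ((a * v $ 0 + b * v $ 1 + c * v $ 2) * cnj (v $ 0)
      + (b * v $ 0 + d * v $ 1 + e * v $ 2) * cnj (v $ 1)
      + (c * v $ 0 + e * v $ 1 + f * v $ 2) * cnj (v $ 2))"
    unfolding qform_def scalar_prod_def
    using assms by (simp add: atLeast0LessThan sum_lessThan_3 idx[unfolded One_nat_def])
  then show ?thesis
    by (simp add: ternary_form_def algebra_simps power2_eq_square)
qed

text \<open>Sylvester's criterion, by completing the square twice: with \<open>D = a d - b\<^sup>2\<close> and
  \<open>E = a e - b c\<close> the form \<open>Q\<close> satisfies
  \<open>a D Q = D (a x + b y + c z)\<^sup>2 + (D y + E z)\<^sup>2 + a \<Delta> z\<^sup>2\<close>, where \<open>\<Delta>\<close> is the determinant.\<close>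

lemma ternary_form_pos:
  assumes a: "0 < a" and D: "0 < a * d - b\<^sup>2"
    and det: "0 < a * (d * f - e\<^sup>2) - b * (b * f - c * e) + c * (b * e - c * d)"
    and ne: "x \<noteq> 0 \<or> y \<noteq> 0 \<or> z \<noteq> 0"
  shows "0 < ternary_form [a, b, c, b, d, e, c, e, f] x y z"
proof -
  let ?Q = "ternary_form [a, b, c, b, d, e, c, e, f] x y z"
  define D where "D = a * d - b\<^sup>2"
  define E where "E = a * e - b * c"
  define t where "t = a * (a * (d * f - e\<^sup>2) - b * (b * f - c * e) + c * (b * e - c * d))"
  have t: "0 < t" using a det by (simp add: t_def)
  have "0 < D" using D_def assms(2) by simp
  have eq: "D * (a * ?Q) = D * (a * x + b * y + c * z)\<^sup>2 + (D * y + E * z)\<^sup>2 + t * z\<^sup>2"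
    unfolding ternary_form_def D_def E_def t_def by (simp add: power2_eq_square algebra_simps)
  have "0 < D * (a * x + b * y + c * z)\<^sup>2 + (D * y + E * z)\<^sup>2 + t * z\<^sup>2"
  proof (cases "z = 0")
    case False
    then show ?thesis using t \<open>0 < D\<close> by (intro add_nonneg_pos) auto
  next
    case z: True
    show ?thesis
    proof (cases "y = 0")
      case False
      then show ?thesis using z \<open>0 < D\<close> by (simp add: add_nonneg_pos)
    next
      case True
      then show ?thesis using z ne a \<open>0 < D\<close> by simp
    qed
  qed
  then have "0 < D * (a * ?Q)" using eq by simp
  then show ?thesis using a \<open>0 < D\<close> by (simp add: zero_less_mult_iff)
qed

lemma real_mat3_pos_def:
  assumes "0 < a" "0 < a * d - b\<^sup>2"
    and "0 < a * (d * f - e\<^sup>2) - b * (b * f - c * e) + c * (b * e - c * d)"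
  shows "real_mat3 [a, b, c, b, d, e, c, e, f] \<in> pos_def_mats 3"
  unfolding pos_def_mats_iff
proof (intro conjI ballI impI real_mat3_hermitian)
  fix v :: "complex vec" assume v: "v \<in> carrier_vec 3" "v \<noteq> 0\<^sub>v 3"
  let ?Q = "ternary_form [a, b, c, b, d, e, c, e, f]"
  have nn: "0 \<le> ?Q x y z" for x y z
    using ternary_form_pos[OF assms, of x y z] by (cases "x = 0 \<and> y = 0 \<and> z = 0") (auto simp: ternary_form_def)
  obtain i where "i < 3" "v $ i \<noteq> 0"
    using v by (metis carrier_vecD eq_vecI index_zero_vec)
  then have "(Re (v $ 0) \<noteq> 0 \<or> Re (v $ 1) \<noteq> 0 \<or> Re (v $ 2) \<noteq> 0)
    \<or> (Im (v $ 0) \<noteq> 0 \<or> Im (v $ 1) \<noteq> 0 \<or> Im (v $ 2) \<noteq> 0)"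
    by (auto simp: less_3_cases complex_eq_iff)
  then show "0 < qform (real_mat3 [a, b, c, b, d, e, c, e, f]) v"
    unfolding qform_real_mat3[OF v(1)]
    using ternary_form_pos[OF assms] nn by (smt (verit))
qed

section \<open>The counterexample\<close>

definition A0 :: "complex mat" where "A0 = real_mat3 [12, 0, 0, 0, 4, 0, 0, 0, 10]"

text \<open>The determinant of \<open>15 S\<close> is 1, so the smallest eigenvalue of \<open>S\<close> is only about 0.0023; its eigenvector is
  close to \<open>(4, -1, 3)\<close> and has its largest component along the top eigenvector of \<^term>\<open>A0\<close>.\<close>

definition S0 :: "complex mat" where
  "S0 = real_mat3 [1/15, 1/15, -1/15, 1/15, 11/15, 2/15, -1/15, 2/15, 2/15]"

definition B0 :: "complex mat" where "B0 = S0 * S0 * A0 * (S0 * S0)"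

text \<open>This is \<open>(7/3) (2 f f\<^sup>T + f g\<^sup>T + g f\<^sup>T + 4 g g\<^sup>T)\<close> with \<open>f = (1, -1, -2)\<close> and \<open>g = (4, 1, -4)\<close>. It
  approximates \<open>X\<^sup>-\<^sup>1 (A # B) X\<^sup>-\<^sup>1\<close>, \<open>X = S\<^sup>2\<close>, from below: that matrix is huge in the direction nearly annihilated
  by \<open>X\<close>, where it contributes almost nothing to \<open>A # B\<close>, so rank two is enough. The coefficients
  are a rounded solution of the corresponding problem in two dimensions.\<close>

definition W0 :: "complex mat" where
  "W0 = real_mat3 [518/3, 77/3, -560/3, 77/3, 28/3, -70/3, -560/3, -70/3, 616/3]"

lemma X0: "S0 * S0 = real_mat3 [3/225, 10/225, -1/225, 10/225, 126/225, 25/225, -1/225, 25/225, 9/225]"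
  by (simp add: S0_def real_mat3_mult)

lemma A0_pos_def: "A0 \<in> pos_def_mats 3"
  unfolding A0_def by (rule real_mat3_pos_def) auto

lemma S0_pos_def: "S0 \<in> pos_def_mats 3"
  unfolding S0_def by (rule real_mat3_pos_def) (auto simp: power2_eq_square)

lemma B0_pos_def: "B0 \<in> pos_def_mats 3"
  unfolding B0_def using pos_def_sandwich[OF A0_pos_def pos_def_square[OF S0_pos_def]] .

lemma inv_A0: "mat_inv A0 = real_mat3 [1/12, 0, 0, 0, 1/4, 0, 0, 0, 1/10]"
  by (rule mat_inverse_eqI(1)[where n = 3])
     (simp_all add: A0_def real_mat3_carrier real_mat3_mult real_mat3_one)

lemma W0_hermitian: "W0 \<in> hermitian_mats 3"
  unfolding W0_def by (rule real_mat3_hermitian)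

lemma W0_bound: "A0 - W0 * (S0 * S0) * mat_inv A0 * (S0 * S0) * W0 \<in> pos_def_mats 3"
  unfolding X0 inv_A0 unfolding A0_def W0_def real_mat3_mult real_mat3_minus
  by (simp, rule real_mat3_pos_def) (simp_all add: power2_eq_square)

lemma spectral_heron_bound:
  "complex_of_real (37/3) \<cdot>\<^sub>m 1\<^sub>m 3 - (A0 + B0 + complex_of_real 2 \<cdot>\<^sub>m (S0 * A0 * S0)) \<in> pos_def_mats 3"
  unfolding B0_def X0 A0_def S0_def real_mat3_mult real_mat3_one real_mat3_smult real_mat3_add real_mat3_minus
  by (simp, rule real_mat3_pos_def) (simp_all add: power2_eq_square)

text \<open>For \<open>k = 1\<close> weak majorization compares the largest eigenvalues, and \<open>37/3\<close> separates them.\<close>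

lemma geometric_heron_not_weakly_majorized:
  "\<not> eigenvalues_desc (A0 + B0 + 2 \<cdot>\<^sub>m geometric_mean A0 B0)
    \<prec>\<^sub>w eigenvalues_desc (A0 + B0 + 2 \<cdot>\<^sub>m spectral_geometric_mean A0 B0)"
proof
  define G where "G = geometric_mean A0 B0"
  define N where "N = S0 * A0 * S0"
  have G: "G \<in> pos_def_mats 3"
    unfolding G_def by (rule geometric_mean_riccati(1)[OF A0_pos_def B0_pos_def])
  have N: "N \<in> pos_def_mats 3"
    unfolding N_def by (rule pos_def_sandwich[OF A0_pos_def S0_pos_def])
  have sN: "spectral_geometric_mean A0 B0 = N"
    unfolding B0_def N_def by (rule spectral_geometric_mean_eqI[OF A0_pos_def S0_pos_def])
  let ?H = "A0 + B0 + 2 \<cdot>\<^sub>m G" and ?K = "A0 + B0 + 2 \<cdot>\<^sub>m N"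
  have H: "?H \<in> hermitian_mats 3" and K: "?K \<in> hermitian_mats 3"
    using heron_hermitian A0_pos_def B0_pos_def G N by auto
  assume "eigenvalues_desc (A0 + B0 + 2 \<cdot>\<^sub>m geometric_mean A0 B0)
    \<prec>\<^sub>w eigenvalues_desc (A0 + B0 + 2 \<cdot>\<^sub>m spectral_geometric_mean A0 B0)"
  then have "eigenvalues_desc ?H \<prec>\<^sub>w eigenvalues_desc ?K" by (simp add: sN G_def)
  moreover have "eigenvalues_desc ?H \<noteq> []"
    using length_eigenvalues_desc[OF H] by auto
  ultimately have "Max (set (eigenvalues_desc ?H)) \<le> Max (set (eigenvalues_desc ?K))"
    by (rule weakly_majorized_Max_le)
  also have "\<dots> \<le> 37/3"
  proof (rule Max_eigenvalues_le[OF K])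
    fix v :: "complex vec" assume v: "v \<in> carrier_vec 3"
    have Kc: "?K \<in> carrier_mat 3 3" using hermitian_carrier[OF K] .
    let ?C = "complex_of_real (37/3) \<cdot>\<^sub>m 1\<^sub>m 3"
    have C: "?C - ?K \<in> pos_def_mats 3" using spectral_heron_bound by (simp add: N_def)
    have "0 \<le> qform (?C - ?K) v"
      using C v by (rule pos_def_qform_nonneg)
    also have "qform (?C - ?K) v = 37/3 * Re (v \<bullet>c v) - qform ?K v"
      using qform_minus[OF _ Kc v, of ?C] qform_smult[of "1\<^sub>m 3" 3 v "37/3"] v by (simp add: qform_one)
    finally show "qform ?K v \<le> 37/3 * Re (v \<bullet>c v)" by simp
  qed simp
  finally have top: "Max (set (eigenvalues_desc ?H)) \<le> 37/3" .
  \<comment> \<open>An integer approximation of the top eigenvector of the first Heron expression.\<close>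
  define v where "v = vec 3 (\<lambda>i. complex_of_real ([17, 4, 1] ! i))"
  have v: "v \<in> carrier_vec 3" by (simp add: v_def)
  have vi: "v $ 0 = 17" "v $ 1 = 4" "v $ 2 = 1" by (simp_all add: v_def)
  have vv: "Re (v \<bullet>c v) = 306"
    using v by (simp add: scalar_prod_def atLeast0LessThan sum_lessThan_3 vi[unfolded One_nat_def])
  have "qform ?H v = qform A0 v + qform B0 v + 2 * qform G v"
    using pos_def_carrier[OF A0_pos_def] pos_def_carrier[OF B0_pos_def] pos_def_carrier[OF G] v
      qform_smult[of G 3 v 2] by (simp add: qform_add[of _ 3])
  also have "\<dots> \<ge> qform A0 v + qform B0 v + 2 * qform (S0 * S0 * W0 * (S0 * S0)) v"
    using geometric_mean_sandwich_ge[OF A0_pos_def pos_def_square[OF S0_pos_def] W0_hermitian W0_bound v]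
    by (simp add: G_def B0_def)
  \<comment> \<open>The threshold is \<open>37/3 * 306 = 3542 + 232\<close>.\<close>
  moreover have "qform A0 v = 3542"
    unfolding A0_def qform_real_mat3[OF v] by (simp add: ternary_form_def vi[unfolded One_nat_def])
  moreover have "qform B0 v + 2 * qform (S0 * S0 * W0 * (S0 * S0)) v > 232"
    unfolding B0_def X0 A0_def W0_def real_mat3_mult
    by (simp add: qform_real_mat3[OF v] ternary_form_def vi[unfolded One_nat_def])
  ultimately have "37/3 * 306 < qform ?H v" by simp
  also have "\<dots> \<le> Max (set (eigenvalues_desc ?H)) * Re (v \<bullet>c v)"
    by (rule qform_le_Max_eigenvalues[OF H v])
  also have "\<dots> \<le> 37/3 * 306"
    using top by (simp add: vv)
  finally show False by simp
qed

lemma A0_S0_not_commute: "A0 * (S0 * S0) \<noteq> S0 * S0 * A0"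
proof
  assume "A0 * (S0 * S0) = S0 * S0 * A0"
  then have "(A0 * (S0 * S0)) $$ (0, 1) = (S0 * S0 * A0) $$ (0, 1)" by simp
  then show False
    unfolding X0 A0_def real_mat3_mult by (simp add: real_mat3_def)
qed

theorem proposition4p7:
  shows "\<not> (\<forall>(a::real) (b::real) (n::nat). 0 < a \<longrightarrow> 0 < b \<longrightarrow> 1 \<le> n \<longrightarrow>
            (\<forall>A \<in> pos_def_mats n. \<forall>B \<in> pos_def_mats n.
               eigenvalues_desc (complex_of_real (a\<^sup>2) \<cdot>\<^sub>m A + complex_of_real (b\<^sup>2) \<cdot>\<^sub>m B
                 + complex_of_real (2 * a * b) \<cdot>\<^sub>m geometric_mean A B)
               \<prec>\<^sub>w
               eigenvalues_desc (complex_of_real (a\<^sup>2) \<cdot>\<^sub>m A + complex_of_real (b\<^sup>2) \<cdot>\<^sub>m B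
                 + complex_of_real (2 * a * b) \<cdot>\<^sub>m spectral_geometric_mean A B)))
       \<and> \<not> (\<forall>(a::real) (b::real) (n::nat). 0 < a \<longrightarrow> 0 < b \<longrightarrow> 1 \<le> n \<longrightarrow>
            (\<forall>A \<in> pos_def_mats n. \<forall>B \<in> pos_def_mats n.
               eigenvalues_desc (complex_of_real (a\<^sup>2) \<cdot>\<^sub>m A + complex_of_real (b\<^sup>2) \<cdot>\<^sub>m B
                 + complex_of_real (2 * a * b) \<cdot>\<^sub>m spectral_geometric_mean A B)
               \<prec>\<^sub>w
               eigenvalues_desc (complex_of_real (a\<^sup>2) \<cdot>\<^sub>m A + complex_of_real (b\<^sup>2) \<cdot>\<^sub>m B
                 + complex_of_real (2 * a * b) \<cdot>\<^sub>m geometric_mean A B)))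
       \<and> (\<exists>n\<ge>1. \<exists>A \<in> pos_def_mats n. \<exists>B \<in> pos_def_mats n.
            \<not> eigenvalues_desc (A + B + 2 \<cdot>\<^sub>m geometric_mean A B)
              \<prec>\<^sub>w eigenvalues_desc (A + B + 2 \<cdot>\<^sub>m spectral_geometric_mean A B))
       \<and> (\<exists>n\<ge>1. \<exists>A \<in> pos_def_mats n. \<exists>B \<in> pos_def_mats n.
            \<not> eigenvalues_desc (A + B + 2 \<cdot>\<^sub>m spectral_geometric_mean A B)
              \<prec>\<^sub>w eigenvalues_desc (A + B + 2 \<cdot>\<^sub>m geometric_mean A B))"
proof (intro conjI)
  let ?H = "A0 + B0 + 2 \<cdot>\<^sub>m geometric_mean A0 B0"
  let ?K = "A0 + B0 + 2 \<cdot>\<^sub>m spectral_geometric_mean A0 B0"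
  have HK: "\<not> eigenvalues_desc ?H \<prec>\<^sub>w eigenvalues_desc ?K"
    by (rule geometric_heron_not_weakly_majorized)
  have KH: "\<not> eigenvalues_desc ?K \<prec>\<^sub>w eigenvalues_desc ?H"
    by (rule spectral_heron_not_weakly_majorized[OF A0_pos_def S0_pos_def A0_S0_not_commute B0_def])
  \<comment> \<open>At \<open>a = b = 1\<close> the weighted expressions are the unweighted ones.\<close>
  have unit: "1 \<cdot>\<^sub>m C = C" for C :: "complex mat"
    by (rule eq_matI) auto
  have one: "complex_of_real (1\<^sup>2) \<cdot>\<^sub>m A0 + complex_of_real (1\<^sup>2) \<cdot>\<^sub>m B0
      + complex_of_real (2 * 1 * 1) \<cdot>\<^sub>m M = A0 + B0 + 2 \<cdot>\<^sub>m M" for M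
    by (simp add: unit)
  show "\<exists>n\<ge>1. \<exists>A \<in> pos_def_mats n. \<exists>B \<in> pos_def_mats n.
      \<not> eigenvalues_desc (A + B + 2 \<cdot>\<^sub>m geometric_mean A B)
        \<prec>\<^sub>w eigenvalues_desc (A + B + 2 \<cdot>\<^sub>m spectral_geometric_mean A B)"
    using HK A0_pos_def B0_pos_def by (intro exI[of _ 3]) auto
  show "\<exists>n\<ge>1. \<exists>A \<in> pos_def_mats n. \<exists>B \<in> pos_def_mats n.
      \<not> eigenvalues_desc (A + B + 2 \<cdot>\<^sub>m spectral_geometric_mean A B)
        \<prec>\<^sub>w eigenvalues_desc (A + B + 2 \<cdot>\<^sub>m geometric_mean A B)"
    using KH A0_pos_def B0_pos_def by (intro exI[of _ 3]) auto
  show "\<not> (\<forall>(a::real) (b::real) (n::nat). 0 < a \<longrightarrow> 0 < b \<longrightarrow> 1 \<le> n \<longrightarrow>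
            (\<forall>A \<in> pos_def_mats n. \<forall>B \<in> pos_def_mats n.
               eigenvalues_desc (complex_of_real (a\<^sup>2) \<cdot>\<^sub>m A + complex_of_real (b\<^sup>2) \<cdot>\<^sub>m B
                 + complex_of_real (2 * a * b) \<cdot>\<^sub>m geometric_mean A B)
               \<prec>\<^sub>w
               eigenvalues_desc (complex_of_real (a\<^sup>2) \<cdot>\<^sub>m A + complex_of_real (b\<^sup>2) \<cdot>\<^sub>m B
                 + complex_of_real (2 * a * b) \<cdot>\<^sub>m spectral_geometric_mean A B)))"
  proof
    assume "(\<forall>(a::real) (b::real) (n::nat). 0 < a \<longrightarrow> 0 < b \<longrightarrow> 1 \<le> n \<longrightarrow>
            (\<forall>A \<in> pos_def_mats n. \<forall>B \<in> pos_def_mats n.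
               eigenvalues_desc (complex_of_real (a\<^sup>2) \<cdot>\<^sub>m A + complex_of_real (b\<^sup>2) \<cdot>\<^sub>m B
                 + complex_of_real (2 * a * b) \<cdot>\<^sub>m geometric_mean A B)
               \<prec>\<^sub>w
               eigenvalues_desc (complex_of_real (a\<^sup>2) \<cdot>\<^sub>m A + complex_of_real (b\<^sup>2) \<cdot>\<^sub>m B
                 + complex_of_real (2 * a * b) \<cdot>\<^sub>m spectral_geometric_mean A B)))"
    from this[rule_format, of 1 1 3, OF _ _ _ A0_pos_def B0_pos_def] show False
      using HK unfolding one by simp
  qed
  show "\<not> (\<forall>(a::real) (b::real) (n::nat). 0 < a \<longrightarrow> 0 < b \<longrightarrow> 1 \<le> n \<longrightarrow>
            (\<forall>A \<in> pos_def_mats n. \<forall>B \<in> pos_def_mats n.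
               eigenvalues_desc (complex_of_real (a\<^sup>2) \<cdot>\<^sub>m A + complex_of_real (b\<^sup>2) \<cdot>\<^sub>m B
                 + complex_of_real (2 * a * b) \<cdot>\<^sub>m spectral_geometric_mean A B)
               \<prec>\<^sub>w
               eigenvalues_desc (complex_of_real (a\<^sup>2) \<cdot>\<^sub>m A + complex_of_real (b\<^sup>2) \<cdot>\<^sub>m B
                 + complex_of_real (2 * a * b) \<cdot>\<^sub>m geometric_mean A B)))"
  proof
    assume "(\<forall>(a::real) (b::real) (n::nat). 0 < a \<longrightarrow> 0 < b \<longrightarrow> 1 \<le> n \<longrightarrow>
            (\<forall>A \<in> pos_def_mats n. \<forall>B \<in> pos_def_mats n.
               eigenvalues_desc (complex_of_real (a\<^sup>2) \<cdot>\<^sub>m A + complex_of_real (b\<^sup>2) \<cdot>\<^sub>m B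
                 + complex_of_real (2 * a * b) \<cdot>\<^sub>m spectral_geometric_mean A B)
               \<prec>\<^sub>w
               eigenvalues_desc (complex_of_real (a\<^sup>2) \<cdot>\<^sub>m A + complex_of_real (b\<^sup>2) \<cdot>\<^sub>m B
                 + complex_of_real (2 * a * b) \<cdot>\<^sub>m geometric_mean A B)))"
    from this[rule_format, of 1 1 3, OF _ _ _ A0_pos_def B0_pos_def] show False
      using KH unfolding one by simp
  qed
qed

end
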